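(* Let $\mathcal{S}\subseteq \mathcal{G}$ be an isomorphism-invariant closed subspace of the space $\mathcal{G}$ of finitely generated marked groups. Then the following conditions are equivalent. (a) For any non-empty open sets $U$, $V$ in $\mathcal{S}$, there is a finitely generated group $G$ such that $[G]\cap U\neq\emptyset$ and $[G]\cap V\neq\emptyset$. (b) There exists a finitely generated group $G$ such that $[G]$ is dense in $\mathcal{S}$. (c) $\mathcal{S}$ satisfies the zero-one law for $\mathcal{L}_{\omega_1,\omega}$-sentences.
   Context: Space of marked groups: for $n\in\mathbb{N}$, $\mathcal{G}_n$ is the set of pairs $(G,A)$, where $G$ is a group and $A=(a_1,\dots,a_n)$ is an ordered $n$-tuple generating $G$, modulo identifying $(G,(a_1,\dots,a_n))$ with $(H,(b_1,\dots,b_n))$ whenever $a_i\mapsto b_i$ ($i=1,\dots,n$) extends to an isomorphism $G\to H$. For $r\in\mathbb{N}$ write $(G,A)\approx_r(H,B)$ (for elements of $\mathcal{G}_n$) if there is an isomorphism of directed graphs, taking identity to identity, between the balls of radius $r$ around the identity in the Cayley graphs $\Gamma(G,A)$ and $\Gamma(H,B)$ that takes edges labeled by $a_i$ to edges labeled by $b_i$ for all $i$ (the ball of radius $r$ consists of all vertices at distance at most $r$ from the identity and all edges with at least one end at distance at most $r-1$). The sets $\{(H,B)\in\mathcal{G}_n\mid (H,B)\approx_r(G,A)\}$ form a base of the topology of $\mathcal{G}_n$. Identifying $(G,(a_1,\dots,a_n))$ with $(G,(a_1,\dots,a_n,1))$ embeds $\mathcal{G}_n$ in $\mathcal{G}_{n+1}$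 as a clopen subset, and $\mathcal{G}=\bigcup_{n}\mathcal{G}_n$ is the topological union; it is a Polish space. For a finitely generated group $G$, $[G]=\{(H,B)\in\mathcal{G}\mid H\cong G\}$. A subset $\mathcal{S}\subseteq\mathcal{G}$ is isomorphism-invariant if $[G]\subseteq\mathcal{S}$ whenever $(G,A)\in\mathcal{S}$ for some finite generating set $A$. $\mathcal{L}$ is the first-order language of groups with signature $\{1,\cdot,{}^{-1}\}$; $\mathcal{L}_{\omega_1,\omega}$ is its infinitary version in which countable conjunctions and disjunctions (but only finite strings of quantifiers) are allowed. For an $\mathcal{L}_{\omega_1,\omega}$-sentence $\sigma$, $\mathrm{Mod}_{\mathcal{S}}(\sigma)=\{(G,A)\in\mathcal{S}\mid G\models\sigma\}$. $\mathcal{S}$ satisfies the zero-one law for $\mathcal{L}_{\omega_1,\omega}$-sentences if for every $\mathcal{L}_{\omega_1,\omega}$-sentence $\sigma$ the set $\mathrm{Mod}_{\mathcal{S}}(\sigma)$ is either meager or comeager in $\mathcal{S}$. *)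

theory Defs
  imports "HOL-Analysis.Analysis" "HOL-Algebra.Generated_Groups"
begin

definition fin_gen_group :: "('a, 'b) monoid_scheme \<Rightarrow> bool" where
  "fin_gen_group G \<longleftrightarrow>
     group G \<and> (\<exists>A. finite A \<and> A \<subseteq> carrier G \<and> generate G A = carrier G)"

definition marked :: "('a, 'b) monoid_scheme \<Rightarrow> 'a list \<Rightarrow> bool" where
  "marked G A \<longleftrightarrow> group G \<and> set A \<subseteq> carrier G \<and> generate G (set A) = carrier G"

(* The lists A and B are required to have the same length: this is the identification
   that defines the space of n-marked groups. *)
definition marked_iso ::
  "('a, 'c) monoid_scheme \<Rightarrow> 'a list \<Rightarrow> ('b, 'd) monoid_scheme \<Rightarrow> 'b list \<Rightarrow> bool" where
  "marked_iso G A H B \<longleftrightarrow> (\<exists>f \<in> iso G H. map f A = B)"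

(* The identification on the union of all spaces of n-marked groups: isomorphism of marked
   groups together with the identification of (G, A) and (G, A @ [1]).  Every finitely
   generated group is countable, so groups with carrier in nat represent all of them. *)
definition marked_eq :: "nat monoid \<times> nat list \<Rightarrow> nat monoid \<times> nat list \<Rightarrow> bool" where
  "marked_eq = (\<lambda>(G, A) (H, B). marked G A \<and> marked H B \<and>
     (\<exists>k l. marked_iso G (A @ replicate k \<one>\<^bsub>G\<^esub>) H (B @ replicate l \<one>\<^bsub>H\<^esub>)))"

lemma marked_iso_pad:
  assumes "marked_iso G A H B" "group G" "group H"
  shows "marked_iso G (A @ replicate k \<one>\<^bsub>G\<^esub>) H (B @ replicate k \<one>\<^bsub>H\<^esub>)"
proof -
  from assms(1) obtain f where f: "f \<in> iso G H" "map f A = B"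
    unfolding marked_iso_def by blast
  then have "f \<one>\<^bsub>G\<^esub> = \<one>\<^bsub>H\<^esub>"
    using assms by (simp add: hom_one iso_def)
  with f show ?thesis unfolding marked_iso_def by auto
qed

lemma marked_iso_refl: "marked_iso G A G A"
  unfolding marked_iso_def by (intro bexI[of _ id] id_iso) simp

lemma marked_iso_sym:
  assumes "marked_iso G A H B" "group G" "set A \<subseteq> carrier G"
  shows "marked_iso H B G A"
proof -
  from assms(1) obtain f where f: "f \<in> iso G H" "map f A = B"
    unfolding marked_iso_def by blast
  interpret group G by fact
  have inj: "inj_on f (carrier G)" using f by (simp add: iso_def bij_betw_def)
  have "map (inv_into (carrier G) f \<circ> f) A = A"
    using assms(3) inj by (intro map_idI) (auto simp: inv_into_f_f)
  then have "map (inv_into (carrier G) f) B = A"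
    using f(2) by auto
  with iso_set_sym[OF f(1)] show ?thesis unfolding marked_iso_def by blast
qed

lemma marked_iso_trans:
  assumes "marked_iso G A H B" "marked_iso H B K C"
  shows "marked_iso G A K C"
proof -
  from assms obtain f h where "f \<in> iso G H" "map f A = B" "h \<in> iso H K" "map h B = C"
    unfolding marked_iso_def by blast
  then have "h \<circ> f \<in> iso G K" "map (h \<circ> f) A = C"
    by (auto intro: iso_set_trans)
  then show ?thesis unfolding marked_iso_def by blast
qed

lemma marked_eq_sym: "marked_eq x y \<Longrightarrow> marked_eq y x"
proof -
  assume "marked_eq x y"
  moreover obtain G A H B where xy: "x = (G, A)" "y = (H, B)" by (cases x, cases y)
  ultimately obtain k l where m: "marked G A" "marked H B"
    and i: "marked_iso G (A @ replicate k \<one>\<^bsub>G\<^esub>) H (B @ replicate l \<one>\<^bsub>H\<^esub>)"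
    unfolding marked_eq_def by auto
  have g: "group G" using m by (simp add: marked_def)
  then have "set (A @ replicate k \<one>\<^bsub>G\<^esub>) \<subseteq> carrier G"
    using m(1) by (auto simp: marked_def group.is_monoid monoid.one_closed)
  from marked_iso_sym[OF i g this] m show ?thesis
    unfolding marked_eq_def xy by auto
qed

lemma marked_eq_trans:
  assumes "marked_eq x y" "marked_eq y z" shows "marked_eq x z"
proof -
  obtain G A H B K C where xyz: "x = (G, A)" "y = (H, B)" "z = (K, C)"
    by (cases x, cases y, cases z)
  with assms obtain k l p q where m: "marked G A" "marked H B" "marked K C"
    and i: "marked_iso G (A @ replicate k \<one>\<^bsub>G\<^esub>) H (B @ replicate l \<one>\<^bsub>H\<^esub>)"
    and j: "marked_iso H (B @ replicate p \<one>\<^bsub>H\<^esub>) K (C @ replicate q \<one>\<^bsub>K\<^esub>)"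
    unfolding marked_eq_def by auto
  have g: "group G" "group H" "group K" using m by (auto simp: marked_def)
  have "marked_iso G (A @ replicate (k + p) \<one>\<^bsub>G\<^esub>) H (B @ replicate (l + p) \<one>\<^bsub>H\<^esub>)"
    using marked_iso_pad[OF i g(1,2), of p] by (simp add: replicate_add)
  moreover have "marked_iso H (B @ replicate (l + p) \<one>\<^bsub>H\<^esub>) K (C @ replicate (q + l) \<one>\<^bsub>K\<^esub>)"
    using marked_iso_pad[OF j g(2,3), of l]
    by (simp add: replicate_add[symmetric]) (simp add: add.commute[of l p])
  ultimately show ?thesis
    using m unfolding marked_eq_def xyz by (auto dest: marked_iso_trans)
qed

lemma marked_eq_refl: "marked G A \<Longrightarrow> marked_eq (G, A) (G, A)"
  unfolding marked_eq_def using marked_iso_refl by auto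

lemma ex_marked: "\<exists>x :: nat monoid \<times> nat list. marked_eq x x"
proof -
  define G :: "nat monoid" where "G = \<lparr>carrier = {0}, mult = (+), one = 0\<rparr>"
  have "group G" by (rule groupI) (auto simp: G_def)
  moreover have "generate G {} = carrier G"
    using \<open>group G\<close> by (simp add: group.generate_empty) (simp add: G_def)
  ultimately have "marked G []" by (simp add: marked_def)
  then show ?thesis using marked_eq_refl by blast
qed

quotient_type marked_group = "nat monoid \<times> nat list" / partial: marked_eq
  by (intro part_equivpI ex_marked sympI transpI) (blast intro: marked_eq_sym marked_eq_trans)+

definition mk :: "nat monoid \<Rightarrow> nat list \<Rightarrow> marked_group" where
  "mk G A = abs_marked_group (G, A)"

lemma mk_eq_iff:
  assumes "marked G A" "marked H B"
  shows "mk G A = mk H B \<longleftrightarrow> marked_eq (G, A) (H, B)"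
  using Quotient3_rel[OF Quotient3_marked_group, of "(G, A)" "(H, B)"]
    marked_eq_refl[OF assms(1)] marked_eq_refl[OF assms(2)]
  by (simp add: mk_def)

lemma ex_mk: "\<exists>G A. marked G A \<and> x = mk G A"
proof -
  obtain y where "marked_eq y y" "abs_marked_group y = x"
    using Quotient3_abs_rep[OF Quotient3_marked_group]
      Quotient3_rep_reflp[OF Quotient3_marked_group] by blast
  then show ?thesis by (cases y) (auto simp: mk_def marked_eq_def)
qed

(* The copy of the space of n-marked groups in the union. *)
definition n_marked_groups :: "nat \<Rightarrow> marked_group set" where
  "n_marked_groups n = {mk G A | G A. marked G A \<and> length A = n}"

(* The edge from g to g a_i labelled by a_i; edges with different labels are kept apart
   even if the generators coincide, so an edge is determined by its ends and its label. *)
definition cayley_edges :: "('a, 'b) monoid_scheme \<Rightarrow> 'a list \<Rightarrow> ('a \<times> nat \<times> 'a) set" where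
  "cayley_edges G A = {(g, i, g \<otimes>\<^bsub>G\<^esub> (A ! i)) | g i. g \<in> carrier G \<and> i < length A}"

(* Distances ignore the direction of edges. *)
definition cayley_dist :: "('a, 'b) monoid_scheme \<Rightarrow> 'a list \<Rightarrow> 'a \<Rightarrow> 'a \<Rightarrow> nat" where
  "cayley_dist G A g h =
     (LEAST k. (g, h) \<in> {(u, v). \<exists>i. (u, i, v) \<in> cayley_edges G A
                                     \<or> (v, i, u) \<in> cayley_edges G A} ^^ k)"

definition ball_verts :: "nat \<Rightarrow> ('a, 'b) monoid_scheme \<Rightarrow> 'a list \<Rightarrow> 'a set" where
  "ball_verts r G A = {g \<in> carrier G. cayley_dist G A \<one>\<^bsub>G\<^esub> g \<le> r}"

(* An end at distance at most r - 1, written with < because of r = 0. *)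
definition ball_edges :: "nat \<Rightarrow> ('a, 'b) monoid_scheme \<Rightarrow> 'a list \<Rightarrow> ('a \<times> nat \<times> 'a) set" where
  "ball_edges r G A = {(g, i, h) \<in> cayley_edges G A.
     cayley_dist G A \<one>\<^bsub>G\<^esub> g < r \<or> cayley_dist G A \<one>\<^bsub>G\<^esub> h < r}"

definition balls_iso ::
  "nat \<Rightarrow> ('a, 'c) monoid_scheme \<Rightarrow> 'a list \<Rightarrow> ('b, 'd) monoid_scheme \<Rightarrow> 'b list \<Rightarrow> bool" where
  "balls_iso r G A H B \<longleftrightarrow>
     (\<exists>f. bij_betw f (ball_verts r G A) (ball_verts r H B) \<and> f \<one>\<^bsub>G\<^esub> = \<one>\<^bsub>H\<^esub> \<and>
          (\<lambda>(g, i, h). (f g, i, f h)) ` ball_edges r G A = ball_edges r H B)"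

definition marked_nbhd :: "nat \<Rightarrow> nat monoid \<Rightarrow> nat list \<Rightarrow> marked_group set" where
  "marked_nbhd r G A =
     {mk H B | H B. marked H B \<and> length B = length A \<and> balls_iso r H B G A}"

(* The generating sets are in fact a base: the balls of radius r determine those of smaller
   radius, so the neighbourhoods of a point are nested. *)
definition n_marked_topology :: "nat \<Rightarrow> marked_group topology" where
  "n_marked_topology n =
     topology_generated_by {marked_nbhd r G A | r G A. marked G A \<and> length A = n}"

lemma balls_iso_refl: "balls_iso r G A G A"
  unfolding balls_iso_def by (intro exI[of _ "\<lambda>x. x"]) (auto simp: bij_betw_def)

lemma topspace_n_marked_topology: "topspace (n_marked_topology n) = n_marked_groups n"
  unfolding n_marked_topology_def topology_generated_by_topspace
proof (intro equalityI subsetI)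
  fix x assume "x \<in> n_marked_groups n"
  then obtain G A where x: "x = mk G A" "marked G A" "length A = n"
    unfolding n_marked_groups_def by blast
  then have "x \<in> marked_nbhd 0 G A"
    unfolding marked_nbhd_def using balls_iso_refl by blast
  then show "x \<in> \<Union>{marked_nbhd r G A |r G A. marked G A \<and> length A = n}"
    using x by blast
qed (auto simp: marked_nbhd_def n_marked_groups_def)

(* Topological union: a set is open iff its trace on each space of n-marked groups is. *)
instantiation marked_group :: topological_space
begin

definition open_marked_group :: "marked_group set \<Rightarrow> bool" where
  "open_marked_group U \<longleftrightarrow> (\<forall>n. openin (n_marked_topology n) (U \<inter> n_marked_groups n))"

instance
proof
  show "open (UNIV :: marked_group set)"
    by (simp add: open_marked_group_def flip: topspace_n_marked_topology)
next
  fix S T :: "marked_group set" assume "open S" "open T"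
  moreover have "S \<inter> T \<inter> n_marked_groups n = (S \<inter> n_marked_groups n) \<inter> (T \<inter> n_marked_groups n)"
    for n by blast
  ultimately show "open (S \<inter> T)"
    unfolding open_marked_group_def by (metis openin_Int)
next
  fix K :: "marked_group set set" assume "\<forall>S\<in>K. open S"
  then have "openin (n_marked_topology n) (\<Union>((\<lambda>S. S \<inter> n_marked_groups n) ` K))" for n
    unfolding open_marked_group_def by (intro openin_Union) blast
  moreover have "\<Union>K \<inter> n_marked_groups n = \<Union>((\<lambda>S. S \<inter> n_marked_groups n) ` K)" for n
    by blast
  ultimately show "open (\<Union>K)"
    unfolding open_marked_group_def by metis
qed

end

definition iso_class :: "('a, 'b) monoid_scheme \<Rightarrow> marked_group set" where
  "iso_class G = {mk H B | H B. marked H B \<and> H \<cong> G}"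

definition iso_invariant :: "marked_group set \<Rightarrow> bool" where
  "iso_invariant S \<longleftrightarrow> (\<forall>G A. marked G A \<and> mk G A \<in> S \<longrightarrow> iso_class G \<subseteq> S)"

lemma iso_class_subset:
  assumes "iso_invariant S" "iso_class G \<inter> S \<noteq> {}"
  shows "iso_class G \<subseteq> S"
proof -
  obtain H B where H: "marked H B" "H \<cong> G" "mk H B \<in> S"
    using assms(2) unfolding iso_class_def by blast
  then have "G \<cong> H" by (simp add: group.iso_sym marked_def)
  then have "iso_class G \<subseteq> iso_class H"
    unfolding iso_class_def by (auto intro: iso_trans)
  with H assms(1) show ?thesis unfolding iso_invariant_def by blast
qed

datatype gterm = Var nat | One | Mult gterm gterm | Inv gterm

(* Finite conjunctions and disjunctions are sequences with repetitions.  Every subformula of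
   a sentence has only finitely many free variables, because it lies in the scope of only
   finitely many quantifiers. *)
datatype formula =
    Eq gterm gterm
  | Neg formula
  | Conj "nat \<Rightarrow> formula"
  | Disj "nat \<Rightarrow> formula"
  | All nat formula
  | Ex nat formula

primrec term_vars :: "gterm \<Rightarrow> nat set" where
  "term_vars (Var x) = {x}"
| "term_vars One = {}"
| "term_vars (Mult s t) = term_vars s \<union> term_vars t"
| "term_vars (Inv t) = term_vars t"

primrec free_vars :: "formula \<Rightarrow> nat set" where
  "free_vars (Eq s t) = term_vars s \<union> term_vars t"
| "free_vars (Neg \<phi>) = free_vars \<phi>"
| "free_vars (Conj F) = (\<Union>n. free_vars (F n))"
| "free_vars (Disj F) = (\<Union>n. free_vars (F n))"
| "free_vars (All x \<phi>) = free_vars \<phi> - {x}"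
| "free_vars (Ex x \<phi>) = free_vars \<phi> - {x}"

definition is_sentence :: "formula \<Rightarrow> bool" where
  "is_sentence \<sigma> \<longleftrightarrow> free_vars \<sigma> = {}"

primrec term_val :: "('a, 'b) monoid_scheme \<Rightarrow> (nat \<Rightarrow> 'a) \<Rightarrow> gterm \<Rightarrow> 'a" where
  "term_val G e (Var x) = e x"
| "term_val G e One = \<one>\<^bsub>G\<^esub>"
| "term_val G e (Mult s t) = term_val G e s \<otimes>\<^bsub>G\<^esub> term_val G e t"
| "term_val G e (Inv t) = inv\<^bsub>G\<^esub> (term_val G e t)"

primrec sat :: "('a, 'b) monoid_scheme \<Rightarrow> formula \<Rightarrow> (nat \<Rightarrow> 'a) \<Rightarrow> bool" where
  "sat G (Eq s t) = (\<lambda>e. term_val G e s = term_val G e t)"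
| "sat G (Neg \<phi>) = (\<lambda>e. \<not> sat G \<phi> e)"
| "sat G (Conj F) = (\<lambda>e. \<forall>n. sat G (F n) e)"
| "sat G (Disj F) = (\<lambda>e. \<exists>n. sat G (F n) e)"
| "sat G (All x \<phi>) = (\<lambda>e. \<forall>a \<in> carrier G. sat G \<phi> (e(x := a)))"
| "sat G (Ex x \<phi>) = (\<lambda>e. \<exists>a \<in> carrier G. sat G \<phi> (e(x := a)))"

definition models :: "('a, 'b) monoid_scheme \<Rightarrow> formula \<Rightarrow> bool" where
  "models G \<sigma> \<longleftrightarrow> (\<forall>e \<in> UNIV \<rightarrow> carrier G. sat G \<sigma> e)"

definition models_in :: "marked_group set \<Rightarrow> formula \<Rightarrow> marked_group set" where
  "models_in S \<sigma> = {mk G A | G A. marked G A \<and> mk G A \<in> S \<and> models G \<sigma>}"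

definition nowhere_dense_in :: "'a topology \<Rightarrow> 'a set \<Rightarrow> bool" where
  "nowhere_dense_in X N \<longleftrightarrow> N \<subseteq> topspace X \<and> X interior_of (X closure_of N) = {}"

definition meager_in :: "'a topology \<Rightarrow> 'a set \<Rightarrow> bool" where
  "meager_in X M \<longleftrightarrow> (\<exists>\<N>. countable \<N> \<and> (\<forall>N \<in> \<N>. nowhere_dense_in X N) \<and> M = \<Union>\<N>)"

definition comeager_in :: "'a topology \<Rightarrow> 'a set \<Rightarrow> bool" where
  "comeager_in X M \<longleftrightarrow> M \<subseteq> topspace X \<and> meager_in X (topspace X - M)"

definition zero_one_law :: "marked_group set \<Rightarrow> bool" where
  "zero_one_law S \<longleftrightarrow>
     (\<forall>\<sigma>. is_sentence \<sigma> \<longrightarrow>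
        meager_in (top_of_set S) (models_in S \<sigma>) \<or> comeager_in (top_of_set S) (models_in S \<sigma>))"

(* D is not required to be a subset of the space, only to meet all its non-empty open sets.
   For an isomorphism class in a non-empty isomorphism-invariant S, containment follows by
   iso_class_subset; for S = {} every class counts as dense. *)
definition dense_in_space :: "'a topology \<Rightarrow> 'a set \<Rightarrow> bool" where
  "dense_in_space X D \<longleftrightarrow> X closure_of D = topspace X"

end

theory Submission
  imports Defs
begin

text \<open>A marked group is determined by the set of pairs of group terms that agree in it, and for a
  fixed number of generators the topology is that of pointwise convergence of these sets. They form
  a closed family, so the Baire category theorem holds in every closed subspace.

  If two markings \<open>A\<close> and \<open>B\<close> generate the same group, expressing \<open>B\<close> in terms of \<open>A\<close> and
  conversely gives a homeomorphism between neighbourhoods of \<open>(G, A)\<close> and \<open>(G, B)\<close> that only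
  changes the marking, never the group. Hence saturations of open sets are open, and transitivity
  with the Baire category theorem yields a point whose class meets every basic open set. The models
  of a sentence have the Baire property; were they neither meager nor comeager, they would be
  generic in one open set and their complement in another, which a local homeomorphism of this kind
  between the two open sets contradicts. Conversely, that a group admits a marking in a
  given basic open set is expressible by a sentence, so the zero-one law forces transitivity.\<close>

section \<open>Terms and relations of marked groups\<close>

text \<open>The logical part rests on two facts: terms are countable, and their values exhaust a
  marked group. A quantifier over the group is therefore a countable conjunction or disjunction over
  terms, so that the sets defined by formulas arise from open sets by complements and countable
  unions. Conversely, to say that a tuple generates takes a countable disjunction of equations under
  a universal quantifier, which is where the infinitary language enters. The family of relation sets
  is closed because each instance of a group or congruence axiom mentions only finitely many pairs
  of terms. Isomorphism is handled by partial maps instead of a group action: a given tuple of terms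
  generates the whole group only at some points, so each change of marking is paired with terms that
  undo it, and the equations saying so cut out its open domain.\<close>

instance gterm :: countable
  by countable_datatype

text \<open>The value \<open>\<one>\<close> past the end of the list makes appended identities
  invisible, so evaluation respects the identification of markings of different lengths. One set of
  terms, with variables from all of \<open>nat\<close>, serves every number of generators.\<close>

definition marking_env :: "('a, 'b) monoid_scheme \<Rightarrow> 'a list \<Rightarrow> nat \<Rightarrow> 'a" where
  "marking_env G A i = (if i < length A then A ! i else \<one>\<^bsub>G\<^esub>)"

abbreviation tval :: "('a, 'b) monoid_scheme \<Rightarrow> 'a list \<Rightarrow> gterm \<Rightarrow> 'a" where
  "tval G A \<equiv> term_val G (marking_env G A)"

lemma marking_env_pad: "marking_env G (A @ replicate k \<one>\<^bsub>G\<^esub>) = marking_env G A"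
  by (auto simp: marking_env_def nth_append fun_eq_iff)

lemma (in group) term_val_closed:
  assumes "\<And>i. e i \<in> carrier G" shows "term_val G e t \<in> carrier G"
  using assms by (induction t) auto

lemma marking_env_closed:
  assumes "group G" "set A \<subseteq> carrier G" shows "marking_env G A i \<in> carrier G"
  using assms by (auto simp: marking_env_def group.is_monoid monoid.one_closed)

lemma tval_closed:
  assumes "group G" "set A \<subseteq> carrier G" shows "tval G A t \<in> carrier G"
  using group.term_val_closed[OF assms(1)] marking_env_closed[OF assms] by blast

lemma marked_group: "marked G A \<Longrightarrow> group G" and marked_subset: "marked G A \<Longrightarrow> set A \<subseteq> carrier G"
  by (simp_all add: marked_def)

lemma range_tval:
  assumes "group G" "set A \<subseteq> carrier G"
  shows "range (tval G A) = generate G (set A)"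
proof (intro equalityI subsetI)
  interpret group G by fact
  fix g assume "g \<in> range (tval G A)"
  then obtain t where "g = tval G A t" by blast
  moreover have "tval G A t \<in> generate G (set A)"
    using assms(2)
    by (induction t) (auto simp: marking_env_def intro: generate.intros generate_m_inv_closed)
  ultimately show "g \<in> generate G (set A)" by simp
next
  interpret group G by fact
  fix g assume "g \<in> generate G (set A)"
  then show "g \<in> range (tval G A)"
  proof induction
    case one
    show ?case by (rule range_eqI[of _ _ One]) simp
  next
    case (incl h)
    then obtain i where "i < length A" "h = A ! i" by (auto simp: in_set_conv_nth)
    then show ?case by (intro range_eqI[of _ _ "Var i"]) (simp add: marking_env_def)
  next
    case (inv h)
    then obtain i where "i < length A" "h = A ! i" by (auto simp: in_set_conv_nth)
    then show ?case by (intro range_eqI[of _ _ "Inv (Var i)"]) (simp add: marking_env_def)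
  next
    case (eng h1 h2)
    then obtain s t where "h1 = tval G A s" "h2 = tval G A t" by blast
    then show ?case by (intro range_eqI[of _ _ "Mult s t"]) simp
  qed
qed

lemma marked_iff_range_tval:
  "marked G A \<longleftrightarrow> group G \<and> set A \<subseteq> carrier G \<and> carrier G \<subseteq> range (tval G A)"
proof (cases "group G \<and> set A \<subseteq> carrier G")
  case True
  then have "range (tval G A) \<subseteq> carrier G" by (auto intro!: tval_closed)
  with True show ?thesis by (auto simp: marked_def simp flip: range_tval)
qed (auto simp: marked_def)

lemma marked_carrier: "marked G A \<Longrightarrow> carrier G = range (tval G A)"
  by (simp add: marked_def range_tval)

lemma hom_term_val:
  assumes "group G" "group H" "f \<in> hom G H" "\<And>i. e i \<in> carrier G"
  shows "f (term_val G e t) = term_val H (f \<circ> e) t"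
proof -
  interpret group_hom G H f
    using assms by (simp add: group_hom_def group_hom_axioms_def)
  show ?thesis by (induction t) (simp_all add: assms(4) G.term_val_closed)
qed

lemma marked_eq_tval:
  assumes "marked_eq (G, A) (H, B)"
  obtains f where "f \<in> iso G H" "\<And>t. f (tval G A t) = tval H B t"
proof -
  from assms obtain k l where m: "marked G A" "marked H B"
    and "marked_iso G (A @ replicate k \<one>\<^bsub>G\<^esub>) H (B @ replicate l \<one>\<^bsub>H\<^esub>)"
    unfolding marked_eq_def by auto
  then obtain f where f: "f \<in> iso G H"
    and map: "map f (A @ replicate k \<one>\<^bsub>G\<^esub>) = B @ replicate l \<one>\<^bsub>H\<^esub>" (is "map f ?A = ?B")
    unfolding marked_iso_def by blast
  note g = marked_group[OF m(1)] marked_group[OF m(2)]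
  have "f \<one>\<^bsub>G\<^esub> = \<one>\<^bsub>H\<^esub>" using f g by (simp add: hom_one iso_def)
  then have "f (marking_env G ?A i) = marking_env H (map f ?A) i" for i
    by (auto simp: marking_env_def nth_append)
  then have "f \<circ> marking_env G A = marking_env H B"
    unfolding map by (simp add: fun_eq_iff marking_env_pad)
  moreover have "f (tval G A t) = term_val H (f \<circ> marking_env G A) t" for t
    using f by (intro hom_term_val g marking_env_closed marked_subset m) (simp add: iso_def)
  ultimately show thesis using f that by simp
qed

text \<open>The map taking the value of a term under \<open>A\<close> to the value of the same term
  under \<open>B\<close> is well defined and injective by the hypothesis on terms; it is total and
  onto because both tuples generate.\<close>

lemma mk_eqI:
  assumes "marked G A" "marked H B" "\<And>s t. tval G A s = tval G A t \<longleftrightarrow> tval H B s = tval H B t"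
  shows "mk G A = mk H B"
proof -
  note g = marked_group[OF assms(1)] marked_group[OF assms(2)]
  interpret G: group G by (rule g)
  interpret H: group H by (rule g)
  note ran = marked_carrier[OF assms(1)] marked_carrier[OF assms(2)]
  define f where "f g = tval H B (SOME t. g = tval G A t)" for g
  have f: "f (tval G A t) = tval H B t" for t
  proof -
    have "tval G A t = tval G A (SOME s. tval G A t = tval G A s)" by (rule someI) simp
    then show ?thesis unfolding f_def using assms(3) by metis
  qed
  have "f \<in> hom G H"
  proof (rule homI)
    fix x y assume "x \<in> carrier G" "y \<in> carrier G"
    then obtain s t where "x = tval G A s" "y = tval G A t" unfolding ran by blast
    moreover have "f (tval G A (Mult s t)) = tval H B (Mult s t)" by (rule f)
    ultimately show "f (x \<otimes>\<^bsub>G\<^esub> y) = f x \<otimes>\<^bsub>H\<^esub> f y" by (simp add: f)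
  qed (auto simp: ran f)
  moreover have "bij_betw f (carrier G) (carrier H)"
    unfolding ran bij_betw_def by (auto simp: inj_on_def f assms(3) image_image)
  ultimately have iso: "f \<in> iso G H" by (simp add: iso_def)
  have "f \<one>\<^bsub>G\<^esub> = \<one>\<^bsub>H\<^esub>" using f[of One] by simp
  \<comment> \<open>The lists may differ in length; padding both to the greater length is what
    \<open>marked_eq\<close> allows.\<close>
  define n where "n = max (length A) (length B)"
  have "map f (A @ replicate (n - length A) \<one>\<^bsub>G\<^esub>) = B @ replicate (n - length B) \<one>\<^bsub>H\<^esub>"
  proof (rule nth_equalityI)
    fix i
    have "f (marking_env G A i) = marking_env H B i" using f[of "Var i"] by simp
    moreover assume "i < length (map f (A @ replicate (n - length A) \<one>\<^bsub>G\<^esub>))"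
    ultimately show "map f (A @ replicate (n - length A) \<one>\<^bsub>G\<^esub>) ! i
        = (B @ replicate (n - length B) \<one>\<^bsub>H\<^esub>) ! i"
      by (auto simp: marking_env_def nth_append n_def split: if_splits)
  qed (simp add: n_def)
  with iso have "marked_eq (G, A) (H, B)"
    unfolding marked_eq_def marked_iso_def using assms(1,2) by auto
  then show ?thesis using mk_eq_iff assms by blast
qed

definition rep :: "marked_group \<Rightarrow> nat monoid \<times> nat list" where
  "rep x = (SOME p. marked (fst p) (snd p) \<and> x = mk (fst p) (snd p))"

definition grp :: "marked_group \<Rightarrow> nat monoid" where "grp x = fst (rep x)"

definition gens :: "marked_group \<Rightarrow> nat list" where "gens x = snd (rep x)"

lemma marked_grp_gens: "marked (grp x) (gens x)" and mk_grp_gens: "mk (grp x) (gens x) = x"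
proof -
  have "\<exists>p. marked (fst p) (snd p) \<and> x = mk (fst p) (snd p)" using ex_mk[of x] by auto
  from someI_ex[OF this] show "marked (grp x) (gens x)" "mk (grp x) (gens x) = x"
    unfolding grp_def gens_def rep_def by auto
qed

text \<open>The kernel of the evaluation map on the term algebra. By \<open>rel_inj\<close> it
  determines the point, so the pairs of terms act as coordinates on the whole space.\<close>

definition rel :: "marked_group \<Rightarrow> (gterm \<times> gterm) set" where
  "rel x = {(s, t). tval (grp x) (gens x) s = tval (grp x) (gens x) t}"

text \<open>An isomorphism matching two markings commutes with evaluation of terms, so the kernel is
  independent of the representative that \<open>grp\<close> and \<open>gens\<close> happen to
  choose.\<close>

lemma rel_mk:
  assumes "marked G A"
  shows "rel (mk G A) = {(s, t). tval G A s = tval G A t}"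
proof -
  have "marked_eq (G, A) (grp (mk G A), gens (mk G A))"
    using mk_eq_iff[OF assms marked_grp_gens] mk_grp_gens by metis
  then obtain f where f: "f \<in> iso G (grp (mk G A))"
    "\<And>t. f (tval G A t) = tval (grp (mk G A)) (gens (mk G A)) t"
    using marked_eq_tval by blast
  then have "inj_on f (carrier G)" by (simp add: iso_def bij_betw_def)
  then show ?thesis
    unfolding rel_def using assms
    by (auto simp flip: f(2) dest!: inj_onD simp: tval_closed marked_group marked_subset)
qed

lemma rel_inj: "rel x = rel y \<Longrightarrow> x = y"
  using mk_eqI[OF marked_grp_gens marked_grp_gens, of x y] mk_grp_gens
  by (auto simp: rel_def set_eq_iff)

lemma mk_in_n_marked_groups: "marked G A \<Longrightarrow> mk G A \<in> n_marked_groups (length A)"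
  unfolding n_marked_groups_def by (intro CollectI exI conjI) (rule HOL.refl | assumption)+

text \<open>Expressing membership through coordinates, one variable at a time, makes it survive
  pointwise limits.\<close>

lemma n_marked_groups_iff: "x \<in> n_marked_groups n \<longleftrightarrow> (\<forall>i\<ge>n. (Var i, One) \<in> rel x)"
proof
  assume "x \<in> n_marked_groups n"
  then obtain G A where "x = mk G A" "marked G A" "length A = n"
    unfolding n_marked_groups_def by blast
  then show "\<forall>i\<ge>n. (Var i, One) \<in> rel x" by (simp add: rel_mk marking_env_def)
next
  assume *: "\<forall>i\<ge>n. (Var i, One) \<in> rel x"
  obtain G A where x: "x = mk G A" "marked G A" using ex_mk by blast
  note g = marked_group[OF x(2)]
  interpret group G by (rule g)
  \<comment> \<open>\<open>B\<close> truncates or pads \<open>A\<close> to length \<open>n\<close>.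
    Truncation loses nothing, because the dropped generators are trivial by assumption.\<close>
  define B where "B = map (marking_env G A) [0..<n]"
  have env: "marking_env G B = marking_env G A"
  proof
    fix i show "marking_env G B i = marking_env G A i"
    proof (cases "i < n")
      case False
      with * have "(Var i, One) \<in> rel x" by simp
      then show ?thesis using False by (simp add: x rel_mk marking_env_def B_def)
    qed (simp add: B_def marking_env_def)
  qed
  have "set B \<subseteq> carrier G"
    using marking_env_closed[OF g marked_subset[OF x(2)]] by (auto simp: B_def)
  then have m: "marked G B"
    using x(2) unfolding marked_iff_range_tval env by blast
  have "x = mk G B"
    unfolding x by (rule mk_eqI[OF x(2) m]) (simp add: env)
  then show "x \<in> n_marked_groups n"
    using mk_in_n_marked_groups[OF m] by (simp add: B_def)
qed

lemma ex_n_marked_groups: "\<exists>n. x \<in> n_marked_groups n"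
  using mk_in_n_marked_groups[OF marked_grp_gens] mk_grp_gens by metis

section \<open>Congruences on terms whose quotients are groups\<close>

locale group_congruence =
  fixes P :: "(gterm \<times> gterm) set"
  assumes refl: "(t, t) \<in> P" and sym: "(s, t) \<in> P \<Longrightarrow> (t, s) \<in> P"
    and trans: "(s, t) \<in> P \<Longrightarrow> (t, u) \<in> P \<Longrightarrow> (s, u) \<in> P"
    and Mult_cong: "(s, t) \<in> P \<Longrightarrow> (s', t') \<in> P \<Longrightarrow> (Mult s s', Mult t t') \<in> P"
    and Inv_cong: "(s, t) \<in> P \<Longrightarrow> (Inv s, Inv t) \<in> P"
    and assoc: "(Mult (Mult s t) u, Mult s (Mult t u)) \<in> P"
    and One_left: "(Mult One t, t) \<in> P" and Inv_left: "(Mult (Inv t) t, One) \<in> P"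

lemma group_congruence_rel: "group_congruence (rel x)"
proof -
  obtain G A where x: "x = mk G A" "marked G A" using ex_mk by blast
  interpret group G by (rule marked_group[OF x(2)])
  have closed: "tval G A t \<in> carrier G" for t
    using x by (intro tval_closed marked_group marked_subset)
  show ?thesis
    unfolding x(1) rel_mk[OF x(2)] by (rule group_congruence.intro) (simp_all add: m_assoc closed)
qed

text \<open>The quotient of the term algebra, with a class represented by the least code of its
  members.\<close>

lemma (in group_congruence) ex_rel:
  assumes triv: "\<And>i. i \<ge> n \<Longrightarrow> (Var i, One) \<in> P"
  shows "\<exists>x. rel x = P"
proof -
  define c :: "gterm \<Rightarrow> nat" where "c t = (LEAST m. (t, from_nat m) \<in> P)" for t
  have c_P: "(t, from_nat (c t)) \<in> P" for t
    unfolding c_def by (rule LeastI[of _ "to_nat t"]) (simp add: refl)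
  have c_eq: "c s = c t \<longleftrightarrow> (s, t) \<in> P" for s t
  proof
    assume "c s = c t" then show "(s, t) \<in> P" using c_P[of s] c_P[of t] sym trans by metis
  next
    assume "(s, t) \<in> P"
    then have "(s, u) \<in> P \<longleftrightarrow> (t, u) \<in> P" for u using sym trans by blast
    then show "c s = c t" unfolding c_def by simp
  qed
  define G :: "nat monoid" where
    "G = \<lparr>carrier = range c, mult = \<lambda>a b. c (Mult (from_nat a) (from_nat b)), one = c One\<rparr>"
  have mult: "c s \<otimes>\<^bsub>G\<^esub> c t = c (Mult s t)" for s t
    using sym[OF Mult_cong[OF c_P[of s] c_P[of t]]] unfolding G_def by (simp add: c_eq)
  have one: "\<one>\<^bsub>G\<^esub> = c One" and car: "carrier G = range c" by (simp_all add: G_def)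
  have grp: "group G"
  proof (rule groupI)
    fix x assume "x \<in> carrier G"
    then obtain t where "x = c t" by (auto simp: car)
    then show "\<exists>y\<in>carrier G. y \<otimes>\<^bsub>G\<^esub> x = \<one>\<^bsub>G\<^esub>"
      by (intro bexI[of _ "c (Inv t)"]) (auto simp: mult one car c_eq Inv_left)
  qed (auto simp: mult one car c_eq assoc One_left intro!: rangeI)
  interpret group G by fact
  have inv: "inv\<^bsub>G\<^esub> (c t) = c (Inv t)" for t
    by (intro inv_equality) (auto simp: mult one car c_eq Inv_left)
  define A where "A = map (\<lambda>i. c (Var i)) [0..<n]"
  \<comment> \<open>For \<open>i \<ge> n\<close> the environment takes its default value, the class
    of \<open>One\<close>; by \<open>triv\<close> this is the class of \<open>Var i\<close> as
    well.\<close>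
  have "c One = c (Var i)" if "\<not> i < n" for i
    using sym[OF triv] that by (simp add: c_eq)
  then have "marking_env G A i = c (Var i)" for i
    by (simp add: marking_env_def A_def one)
  then have "tval G A t = c t" for t
    by (induction t) (simp_all add: one mult inv)
  then have tval: "tval G A = c" by blast
  have "set A \<subseteq> carrier G" by (auto simp: car A_def)
  then have "marked G A"
    unfolding marked_iff_range_tval using grp by (simp add: car tval)
  then have "rel (mk G A) = P" by (auto simp: rel_mk tval c_eq)
  then show ?thesis by blast
qed

text \<open>Every instance of a congruence axiom, and the triviality of each \<open>Var i\<close>
  with \<open>i \<ge> n\<close>, concerns finitely many pairs. A point agreeing with
  \<open>P\<close> on those pairs passes the instance on to \<open>P\<close>, and
  \<open>ex_rel\<close> then realises \<open>P\<close>.\<close>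

lemma rel_complete:
  assumes "\<And>Q. finite Q \<Longrightarrow> \<exists>x\<in>n_marked_groups n. rel x \<inter> Q = P \<inter> Q"
  shows "\<exists>x\<in>n_marked_groups n. rel x = P"
proof -
  have ex: "\<exists>x. group_congruence (rel x) \<and> x \<in> n_marked_groups n \<and>
      (\<forall>p\<in>set ps. p \<in> rel x \<longleftrightarrow> p \<in> P)" for ps
    using assms[of "set ps"] group_congruence_rel by blast
  have "group_congruence P"
  proof
    fix s t u s' t'
    obtain x where x: "group_congruence (rel x)"
      "\<forall>p\<in>set [(t, t), (s, t), (t, s), (Inv s, Inv t), (t, u), (s, u), (s', t'),
         (Mult s s', Mult t t'), (Mult (Mult s t) u, Mult s (Mult t u)), (Mult One t, t),
         (Mult (Inv t) t, One)]. p \<in> rel x \<longleftrightarrow> p \<in> P"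
      using ex by blast
    interpret group_congruence "rel x" by (rule x)
    show "(t, t) \<in> P" "(Mult (Mult s t) u, Mult s (Mult t u)) \<in> P" "(Mult One t, t) \<in> P"
      "(Mult (Inv t) t, One) \<in> P"
      using x(2) refl assoc One_left Inv_left by simp_all
    assume "(s, t) \<in> P"
    with x(2) have "(s, t) \<in> rel x" by simp
    from sym[OF this] Inv_cong[OF this] show "(t, s) \<in> P" "(Inv s, Inv t) \<in> P"
      using x(2) by simp_all
    show "(s, u) \<in> P" if "(t, u) \<in> P"
      using that x(2) trans[OF \<open>(s, t) \<in> rel x\<close>, of u] by simp
    show "(Mult s s', Mult t t') \<in> P" if "(s', t') \<in> P"
      using that x(2) Mult_cong[OF \<open>(s, t) \<in> rel x\<close>, of s' t'] by simp
  qed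
  moreover have triv: "(Var i, One) \<in> P" if "i \<ge> n" for i
    using ex[of "[(Var i, One)]"] that by (auto simp: n_marked_groups_iff)
  ultimately obtain x where "rel x = P" using group_congruence.ex_rel by blast
  with triv show ?thesis by (auto simp: n_marked_groups_iff)
qed

section \<open>Balls of Cayley graphs and the topology\<close>

text \<open>Edge paths starting at the identity, with the last step first; the flag says whether
  an edge is traversed along its direction.\<close>

primrec path_term :: "(nat \<times> bool) list \<Rightarrow> gterm" where
  "path_term [] = One"
| "path_term (l # w) = Mult (path_term w) (if snd l then Var (fst l) else Inv (Var (fst l)))"

abbreviation pval :: "('a, 'b) monoid_scheme \<Rightarrow> 'a list \<Rightarrow> (nat \<times> bool) list \<Rightarrow> 'a" where
  "pval G A w \<equiv> tval G A (path_term w)"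

definition paths :: "nat \<Rightarrow> nat \<Rightarrow> (nat \<times> bool) list set" where
  "paths n r = {w. set w \<subseteq> {..<n} \<times> UNIV \<and> length w \<le> r}"

lemma finite_paths: "finite (paths n r)"
  unfolding paths_def by (rule finite_lists_length_le) simp

text \<open>The length of this path bounds the radius at which the value of the term becomes
  visible. Factors are swapped because a path lists its last step first; a variable beyond the
  generators has value \<open>\<one>\<close> and contributes no step.\<close>

primrec path_of :: "nat \<Rightarrow> gterm \<Rightarrow> (nat \<times> bool) list" where
  "path_of n (Var i) = (if i < n then [(i, True)] else [])"
| "path_of n One = []"
| "path_of n (Mult s t) = path_of n t @ path_of n s"
| "path_of n (Inv t) = map (apsnd Not) (rev (path_of n t))"

lemma set_path_of: "set (path_of n t) \<subseteq> {..<n} \<times> UNIV"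
  by (induction t) auto

lemma pval_append:
  assumes "group G" "set A \<subseteq> carrier G"
  shows "pval G A (u @ v) = pval G A v \<otimes>\<^bsub>G\<^esub> pval G A u"
proof -
  interpret group G by fact
  show ?thesis
    by (induction u) (use assms in \<open>simp_all add: tval_closed m_assoc marking_env_closed\<close>)
qed

lemma pval_path_of:
  assumes "group G" "set A \<subseteq> carrier G"
  shows "pval G A (path_of (length A) t) = tval G A t"
proof -
  interpret group G by fact
  note closed = tval_closed[OF assms] marking_env_closed[OF assms]
  have inv: "pval G A (map (apsnd Not) (rev w)) = inv\<^bsub>G\<^esub> (pval G A w)" for w
    by (induction w) (simp_all add: pval_append[OF assms] closed inv_mult_group)
  show ?thesis
  proof (induction t)
    case (Var i)
    show ?case using closed(2)[of i] by (auto simp: marking_env_def split: if_splits)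
  qed (simp_all add: pval_append[OF assms] inv)
qed

lemma cayley_adjacent_iff:
  assumes "marked G A" "g \<in> carrier G"
  shows "(\<exists>i. (g, i, h) \<in> cayley_edges G A \<or> (h, i, g) \<in> cayley_edges G A) \<longleftrightarrow>
    (\<exists>i<length A. h = g \<otimes>\<^bsub>G\<^esub> A ! i \<or> h = g \<otimes>\<^bsub>G\<^esub> inv\<^bsub>G\<^esub> (A ! i))"
proof -
  interpret group G using assms by (simp add: marked_def)
  have A: "i < length A \<Longrightarrow> A ! i \<in> carrier G" for i
    using assms by (auto simp: marked_def)
  have "(h \<in> carrier G \<and> g = h \<otimes>\<^bsub>G\<^esub> A ! i) \<longleftrightarrow> h = g \<otimes>\<^bsub>G\<^esub> inv\<^bsub>G\<^esub> (A ! i)"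
    if "i < length A" for i
    using A[OF that] assms(2) by (auto simp: m_assoc)
  then show ?thesis using assms(2) unfolding cayley_edges_def by auto
qed

text \<open>A power of the adjacency relation adds its new step at the far end, which in this
  encoding is the head of the list; each step multiplies on the right by a generator or its
  inverse.\<close>

lemma cayley_relpow_iff:
  assumes "marked G A"
  shows "(\<one>\<^bsub>G\<^esub>, g) \<in> {(u, v). \<exists>i. (u, i, v) \<in> cayley_edges G A
      \<or> (v, i, u) \<in> cayley_edges G A} ^^ k \<longleftrightarrow>
    (\<exists>w. length w = k \<and> set w \<subseteq> {..<length A} \<times> UNIV \<and> g = pval G A w)"
proof (induction k arbitrary: g)
  case 0
  show ?case by auto
next
  case (Suc k)
  let ?E = "{(u, v). \<exists>i. (u, i, v) \<in> cayley_edges G A \<or> (v, i, u) \<in> cayley_edges G A}"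
  let ?W = "\<lambda>k. {w. length w = k \<and> set w \<subseteq> {..<length A} \<times> UNIV}"
  note closed = tval_closed[OF marked_group[OF assms] marked_subset[OF assms]]
  have "(\<exists>w\<in>?W k. \<exists>i<length A. g = pval G A w \<otimes>\<^bsub>G\<^esub> A ! i
      \<or> g = pval G A w \<otimes>\<^bsub>G\<^esub> inv\<^bsub>G\<^esub> (A ! i)) \<longleftrightarrow> (\<exists>w\<in>?W (Suc k). g = pval G A w)" (is "?L \<longleftrightarrow> ?R")
  proof
    assume ?L
    then obtain w i where w: "w \<in> ?W k" "i < length A"
      and "g = pval G A w \<otimes>\<^bsub>G\<^esub> A ! i \<or> g = pval G A w \<otimes>\<^bsub>G\<^esub> inv\<^bsub>G\<^esub> (A ! i)" by blast
    then have "g = pval G A ((i, True) # w) \<or> g = pval G A ((i, False) # w)"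
      by (simp add: marking_env_def)
    moreover have "(i, b) # w \<in> ?W (Suc k)" for b using w by simp
    ultimately show ?R by blast
  next
    assume ?R
    then obtain v where v: "v \<in> ?W (Suc k)" "g = pval G A v" by blast
    then obtain l w where "v = l # w" by (cases v) auto
    moreover obtain i b where "l = (i, b)" by (cases l)
    ultimately have "w \<in> ?W k" "i < length A" "g = pval G A w \<otimes>\<^bsub>G\<^esub> A ! i
      \<or> g = pval G A w \<otimes>\<^bsub>G\<^esub> inv\<^bsub>G\<^esub> (A ! i)"
      using v by (auto simp: marking_env_def)
    then show ?L by blast
  qed
  moreover have "(\<one>\<^bsub>G\<^esub>, g) \<in> ?E ^^ Suc k \<longleftrightarrow> (\<exists>u. (\<one>\<^bsub>G\<^esub>, u) \<in> ?E ^^ k \<and> (u, g) \<in> ?E)"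
    unfolding relpow.simps by (auto simp only: relcomp_unfold mem_Collect_eq case_prod_conv)
  then have "(\<one>\<^bsub>G\<^esub>, g) \<in> ?E ^^ Suc k \<longleftrightarrow> (\<exists>w\<in>?W k. (pval G A w, g) \<in> ?E)"
    unfolding Suc.IH by auto
  ultimately show ?case
    by (simp add: cayley_adjacent_iff[OF assms closed] del: relpow.simps)
qed

lemma Least_le_iff: "(\<exists>k::nat. P k) \<Longrightarrow> (LEAST k. P k) \<le> r \<longleftrightarrow> (\<exists>k\<le>r. P k)"
  by (metis LeastI_ex Least_le order_trans)

lemma cayley_dist_le_iff:
  assumes "marked G A" "g \<in> carrier G"
  shows "cayley_dist G A \<one>\<^bsub>G\<^esub> g \<le> r \<longleftrightarrow> g \<in> pval G A ` paths (length A) r"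
proof -
  note g = marked_group[OF assms(1)] marked_subset[OF assms(1)]
  obtain t where "g = tval G A t" using assms(2) marked_carrier[OF assms(1)] by auto
  then have "\<exists>k w. length w = k \<and> set w \<subseteq> {..<length A} \<times> UNIV \<and> g = pval G A w"
    using set_path_of pval_path_of[OF g] by metis
  then show ?thesis
    unfolding cayley_dist_def cayley_relpow_iff[OF assms(1)]
    by (subst Least_le_iff) (auto simp: paths_def)
qed

lemma cayley_dist_less_iff:
  assumes "marked G A" "g \<in> carrier G"
  shows "cayley_dist G A \<one>\<^bsub>G\<^esub> g < r \<longleftrightarrow> (\<exists>w\<in>paths (length A) r. length w < r \<and> g = pval G A w)"
proof (cases r)
  case (Suc k)
  have "paths (length A) k = {w \<in> paths (length A) (Suc k). length w < Suc k}"
    by (auto simp: paths_def)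
  then show ?thesis
    unfolding Suc less_Suc_eq_le[of _ k] cayley_dist_le_iff[OF assms] by auto
qed simp

lemma ball_verts_eq:
  assumes "marked G A" shows "ball_verts r G A = pval G A ` paths (length A) r"
proof -
  have "pval G A w \<in> carrier G" for w
    by (intro tval_closed marked_group[OF assms] marked_subset[OF assms])
  then show ?thesis
    unfolding ball_verts_def by (auto simp: cayley_dist_le_iff[OF assms])
qed

text \<open>An edge is presented by paths to its two ends, one extending the other by a single step:
  forward from the source or backward from the target. The shorter path has length below
  \<open>r\<close>, so both stay in \<open>paths n r\<close>. The set depends only on
  \<open>n\<close> and \<open>r\<close>, which lets balls of different groups be compared.\<close>

definition edge_paths :: "nat \<Rightarrow> nat \<Rightarrow> ((nat \<times> bool) list \<times> nat \<times> (nat \<times> bool) list) set" where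
  "edge_paths n r = {(u, i, v). u \<in> paths n r \<and> v \<in> paths n r \<and> i < n \<and>
     (length u < r \<and> v = (i, True) # u \<or> length v < r \<and> u = (i, False) # v)}"

lemma ball_edges_eq:
  assumes "marked G A"
  shows "ball_edges r G A = (\<lambda>(u, i, v). (pval G A u, i, pval G A v)) ` edge_paths (length A) r"
    (is "_ = ?f ` _")
proof (intro equalityI subsetI)
  interpret group G using assms by (simp add: marked_def)
  have A: "i < length A \<Longrightarrow> A ! i \<in> carrier G" for i
    using assms by (auto simp: marked_def)
  note closed = tval_closed[OF marked_group[OF assms] marked_subset[OF assms]]
  fix e
  {
    assume "e \<in> ball_edges r G A"
    then obtain g i where e: "e = (g, i, g \<otimes>\<^bsub>G\<^esub> A ! i)" "g \<in> carrier G" "i < length A"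
      and d: "cayley_dist G A \<one>\<^bsub>G\<^esub> g < r \<or> cayley_dist G A \<one>\<^bsub>G\<^esub> (g \<otimes>\<^bsub>G\<^esub> A ! i) < r"
      unfolding ball_edges_def cayley_edges_def by blast
    from d show "e \<in> ?f ` edge_paths (length A) r"
    proof
      assume "cayley_dist G A \<one>\<^bsub>G\<^esub> g < r"
      then obtain u where u: "u \<in> paths (length A) r" "length u < r" "g = pval G A u"
        using cayley_dist_less_iff[OF assms e(2)] by blast
      then have "(u, i, (i, True) # u) \<in> edge_paths (length A) r"
        using e(3) by (simp add: edge_paths_def paths_def)
      moreover have "e = ?f (u, i, (i, True) # u)" using e u(3) by (simp add: marking_env_def)
      ultimately show ?thesis by (rule rev_image_eqI)
    next
      assume "cayley_dist G A \<one>\<^bsub>G\<^esub> (g \<otimes>\<^bsub>G\<^esub> A ! i) < r"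
      then obtain v where v: "v \<in> paths (length A) r" "length v < r"
        "g \<otimes>\<^bsub>G\<^esub> A ! i = pval G A v"
        using cayley_dist_less_iff[OF assms m_closed[OF e(2) A[OF e(3)]]] by blast
      then have "((i, False) # v, i, v) \<in> edge_paths (length A) r"
        using e(3) by (simp add: edge_paths_def paths_def)
      moreover have "e = ?f ((i, False) # v, i, v)"
        using e A v(3)[symmetric] by (simp add: marking_env_def m_assoc)
      ultimately show ?thesis by (rule rev_image_eqI)
    qed
  next
    assume "e \<in> ?f ` edge_paths (length A) r"
    then obtain u i v where e: "e = (pval G A u, i, pval G A v)"
      and uv: "u \<in> paths (length A) r" "v \<in> paths (length A) r" "i < length A"
        "length u < r \<and> v = (i, True) # u \<or> length v < r \<and> u = (i, False) # v"
      unfolding edge_paths_def by auto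
    have "pval G A v = pval G A u \<otimes>\<^bsub>G\<^esub> A ! i"
      using uv(3,4) A closed by (auto simp: marking_env_def m_assoc)
    then have "e \<in> cayley_edges G A"
      using uv(3) closed by (auto simp: cayley_edges_def e)
    moreover have "cayley_dist G A \<one>\<^bsub>G\<^esub> (pval G A u) < r \<or> cayley_dist G A \<one>\<^bsub>G\<^esub> (pval G A v) < r"
      using uv by (auto simp only: cayley_dist_less_iff[OF assms closed])
    ultimately show "e \<in> ball_edges r G A" by (simp add: ball_edges_def e)
  }
qed

text \<open>Sending the end of a path in one graph to the end of the same path in the other is well
  defined and injective by \<open>eq\<close>. Edges go to edges because both balls have their edges
  presented by the same \<open>edge_paths\<close>.\<close>

lemma balls_isoI:
  assumes "marked G A" "marked H B" "length A = length B"
    and eq: "\<And>u v. u \<in> paths (length A) r \<Longrightarrow> v \<in> paths (length A) r \<Longrightarrow>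
      pval G A u = pval G A v \<longleftrightarrow> pval H B u = pval H B v"
  shows "balls_iso r G A H B"
proof -
  define f where "f g = pval H B (SOME w. w \<in> paths (length A) r \<and> g = pval G A w)" for g
  have f: "f (pval G A w) = pval H B w" if "w \<in> paths (length A) r" for w
  proof -
    define v where "v = (SOME v. v \<in> paths (length A) r \<and> pval G A w = pval G A v)"
    have "v \<in> paths (length A) r \<and> pval G A w = pval G A v"
      unfolding v_def by (rule someI[of _ w]) (simp add: that)
    then show ?thesis using eq[OF that] unfolding f_def v_def by auto
  qed
  have "bij_betw f (ball_verts r G A) (ball_verts r H B)"
    unfolding ball_verts_eq[OF assms(1)] ball_verts_eq[OF assms(2)] bij_betw_def
  proof
    show "inj_on f (pval G A ` paths (length A) r)"
      by (auto simp: inj_on_def f eq)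
    show "f ` pval G A ` paths (length A) r = pval H B ` paths (length B) r"
      unfolding image_image using f assms(3) by (intro image_cong) auto
  qed
  moreover have "f \<one>\<^bsub>G\<^esub> = \<one>\<^bsub>H\<^esub>" using f[of "[]"] by (simp add: paths_def)
  moreover have "(\<lambda>(g, i, h). (f g, i, f h)) ` ball_edges r G A = ball_edges r H B"
    unfolding ball_edges_eq[OF assms(1)] ball_edges_eq[OF assms(2)] image_image assms(3)
    by (intro image_cong) (auto simp: edge_paths_def f assms(3) simp del: path_term.simps)
  ultimately show ?thesis unfolding balls_iso_def by blast
qed

text \<open>An isomorphism that respects the identity and the labelled edges has to follow paths:
  every edge crossed by a path of length at most \<open>r\<close> has an end at distance below
  \<open>r\<close>, hence lies in the ball, and induction on the path computes the image of its end.
  Injectivity then transfers coincidences in both directions.\<close>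

lemma balls_isoD:
  assumes "marked G A" "marked H B" "length A = length B" "balls_iso r G A H B"
    and uv: "u \<in> paths (length A) r" "v \<in> paths (length A) r"
  shows "pval G A u = pval G A v \<longleftrightarrow> pval H B u = pval H B v"
proof -
  from assms(4) obtain f where bij: "bij_betw f (ball_verts r G A) (ball_verts r H B)"
    and one: "f \<one>\<^bsub>G\<^esub> = \<one>\<^bsub>H\<^esub>"
    and "(\<lambda>(g, i, h). (f g, i, f h)) ` ball_edges r G A = ball_edges r H B"
    unfolding balls_iso_def by blast
  then have "(f (pval G A u), i, f (pval G A v)) \<in> ball_edges r H B"
    if "(u, i, v) \<in> edge_paths (length A) r" for u i v
    using that unfolding ball_edges_eq[OF assms(1)] by force
  then have edge: "f (pval G A u) \<in> carrier H \<and> f (pval G A v) = f (pval G A u) \<otimes>\<^bsub>H\<^esub> B ! i"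
    if "(u, i, v) \<in> edge_paths (length A) r" for u i v
    using that unfolding ball_edges_def cayley_edges_def by blast
  interpret H: group H using assms(2) by (simp add: marked_def)
  have B: "i < length B \<Longrightarrow> B ! i \<in> carrier H" for i
    using assms(2) by (auto simp: marked_def)
  have f: "f (pval G A w) = pval H B w" if "w \<in> paths (length A) r" for w
    using that
  proof (induction w)
    case Nil
    show ?case by (simp add: one)
  next
    case (Cons l w)
    obtain i b where l: "l = (i, b)" by (cases l)
    have w: "w \<in> paths (length A) r" "length w < r" "i < length A"
      using Cons.prems by (auto simp: paths_def l)
    note IH = Cons.IH[OF w(1)]
    show ?case
    proof (cases b)
      case True
      then have "(w, i, l # w) \<in> edge_paths (length A) r"
        using Cons.prems w by (simp add: edge_paths_def l)
      from edge[OF this] have "f (pval G A (l # w)) = pval H B w \<otimes>\<^bsub>H\<^esub> B ! i"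
        by (simp only: IH)
      also have "\<dots> = pval H B (l # w)"
        using True w assms(3) by (simp add: l marking_env_def)
      finally show ?thesis .
    next
      case False
      \<comment> \<open>A backward step crosses an edge that starts at the new vertex, so the edge
        equation has to be solved for the image of that vertex; this uses that the image lies in
        \<open>H\<close>.\<close>
      then have "(l # w, i, w) \<in> edge_paths (length A) r"
        using Cons.prems w by (simp add: edge_paths_def l)
      from edge[OF this] have "f (pval G A (l # w)) \<in> carrier H"
        "pval H B w = f (pval G A (l # w)) \<otimes>\<^bsub>H\<^esub> B ! i" by (simp_all only: IH)
      then have "f (pval G A (l # w)) = pval H B w \<otimes>\<^bsub>H\<^esub> inv\<^bsub>H\<^esub> (B ! i)"
        using B[of i] w assms(3) by (simp add: H.m_assoc del: path_term.simps)
      also have "\<dots> = pval H B (l # w)"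
        using False w assms(3) by (simp add: l marking_env_def)
      finally show ?thesis .
    qed
  qed
  have "inj_on f (pval G A ` paths (length A) r)"
    using bij_betw_imp_inj_on[OF bij] by (simp only: ball_verts_eq[OF assms(1)])
  from inj_on_eq_iff[OF this imageI[OF uv(1)] imageI[OF uv(2)]] show ?thesis
    by (simp only: f[OF uv(1)] f[OF uv(2)])
qed

lemma balls_iso_trans:
  assumes "balls_iso r G A H B" "balls_iso r H B K C"
  shows "balls_iso r G A K C"
proof -
  from assms obtain f h where f: "bij_betw f (ball_verts r G A) (ball_verts r H B)"
      "f \<one>\<^bsub>G\<^esub> = \<one>\<^bsub>H\<^esub>" "(\<lambda>(g, i, h). (f g, i, f h)) ` ball_edges r G A = ball_edges r H B"
    and h: "bij_betw h (ball_verts r H B) (ball_verts r K C)"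
      "h \<one>\<^bsub>H\<^esub> = \<one>\<^bsub>K\<^esub>" "(\<lambda>(g, i, g'). (h g, i, h g')) ` ball_edges r H B = ball_edges r K C"
    unfolding balls_iso_def by blast
  have "(\<lambda>(g, i, g'). ((h \<circ> f) g, i, (h \<circ> f) g')) ` ball_edges r G A = ball_edges r K C"
    unfolding h(3)[symmetric] f(3)[symmetric] image_image by (intro image_cong) auto
  then show ?thesis
    unfolding balls_iso_def using bij_betw_trans[OF f(1) h(1)] f(2) h(2)
    by (intro exI[of _ "h \<circ> f"]) simp
qed

section \<open>Neighbourhoods given by finite windows of relations\<close>

definition rel_nbhd :: "nat \<Rightarrow> (gterm \<times> gterm) set \<Rightarrow> marked_group \<Rightarrow> marked_group set" where
  "rel_nbhd n F x = {y \<in> n_marked_groups n. rel y \<inter> F = rel x \<inter> F}"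

lemma n_marked_groupsE:
  assumes "x \<in> n_marked_groups n"
  obtains G A where "marked G A" "length A = n" "x = mk G A"
  using assms unfolding n_marked_groups_def by auto

lemma path_bound:
  assumes "finite F"
  obtains r where "\<And>s t. (s, t) \<in> F \<Longrightarrow> path_of n s \<in> paths n r \<and> path_of n t \<in> paths n r"
proof -
  have "finite ((\<lambda>(s, t). length (path_of n s) + length (path_of n t)) ` F)" using assms by simp
  then obtain r where r: "\<forall>m\<in>(\<lambda>(s, t). length (path_of n s) + length (path_of n t)) ` F. m \<le> r"
    unfolding finite_nat_set_iff_bounded_le by auto
  have "path_of n s \<in> paths n r \<and> path_of n t \<in> paths n r" if "(s, t) \<in> F" for s t
    using bspec[OF r imageI[OF that]] set_path_of[of n] by (auto simp: paths_def)
  then show thesis by (rule that)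
qed

lemma marked_nbhdI:
  assumes "marked H B" "length B = length A" "balls_iso r H B G A"
  shows "mk H B \<in> marked_nbhd r G A"
  unfolding marked_nbhd_def by (intro CollectI exI conjI) (rule HOL.refl assms)+

text \<open>A ball is determined by the coincidences among values of paths of length at most
  \<open>r\<close>, and with \<open>n\<close> generators there are only finitely many such
  paths.\<close>

lemma rel_nbhd_subset_marked_nbhd:
  assumes "x \<in> marked_nbhd r G A" "marked G A" "length A = n"
  shows "\<exists>F. finite F \<and> rel_nbhd n F x \<subseteq> marked_nbhd r G A"
proof (intro exI conjI subsetI)
  let ?F = "(\<lambda>(u, v). (path_term u, path_term v)) ` (paths n r \<times> paths n r)"
  show "finite ?F" by (simp add: finite_paths)
  fix y assume y: "y \<in> rel_nbhd n ?F x"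
  then obtain K C where K: "marked K C" "length C = n" "y = mk K C"
    unfolding rel_nbhd_def by (auto elim: n_marked_groupsE)
  obtain H B where H: "x = mk H B" "marked H B" "length B = n" "balls_iso r H B G A"
    using assms(1,3) unfolding marked_nbhd_def by auto
  have "pval K C u = pval K C v \<longleftrightarrow> pval H B u = pval H B v"
    if uv: "u \<in> paths (length C) r" "v \<in> paths (length C) r" for u v
  proof -
    have "(path_term u, path_term v) \<in> ?F"
      using uv K(2) by (intro image_eqI[of _ _ "(u, v)"]) auto
    with y have "(path_term u, path_term v) \<in> rel y \<longleftrightarrow> (path_term u, path_term v) \<in> rel x"
      unfolding rel_nbhd_def by blast
    then show ?thesis by (simp add: K(3) H(1) rel_mk[OF K(1)] rel_mk[OF H(2)])
  qed
  then have "balls_iso r K C H B"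
    using K H by (intro balls_isoI) auto
  then have "balls_iso r K C G A" using H(4) by (rule balls_iso_trans)
  then show "y \<in> marked_nbhd r G A"
    using K assms(3) marked_nbhdI by metis
qed

text \<open>Terms have the same values as their paths, so a radius that accommodates the paths of
  all terms in \<open>F\<close> decides every pair in \<open>F\<close>.\<close>

lemma marked_nbhd_subset_rel_nbhd:
  assumes "finite F" "marked G A"
  shows "\<exists>r. marked_nbhd r G A \<subseteq> rel_nbhd (length A) F (mk G A)"
proof -
  obtain r where r: "\<And>s t. (s, t) \<in> F \<Longrightarrow>
      path_of (length A) s \<in> paths (length A) r \<and> path_of (length A) t \<in> paths (length A) r"
    using path_bound[OF assms(1)] by blast
  have "y \<in> rel_nbhd (length A) F (mk G A)" if "y \<in> marked_nbhd r G A" for y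
  proof -
    from that obtain H B where H: "y = mk H B" "marked H B" "length B = length A"
      "balls_iso r H B G A"
      unfolding marked_nbhd_def by blast
    have "(s, t) \<in> rel y \<longleftrightarrow> (s, t) \<in> rel (mk G A)" if "(s, t) \<in> F" for s t
    proof -
      have "pval H B (path_of (length B) s) = pval H B (path_of (length B) t) \<longleftrightarrow>
          pval G A (path_of (length B) s) = pval G A (path_of (length B) t)"
        using r[OF that] H(3) by (intro balls_isoD[OF H(2) assms(2) H(3,4)]) simp_all
      then have "tval H B s = tval H B t \<longleftrightarrow> tval G A s = tval G A t"
        using H(3) pval_path_of[OF marked_group[OF H(2)] marked_subset[OF H(2)]]
          pval_path_of[OF marked_group[OF assms(2)] marked_subset[OF assms(2)]] by simp
      then show ?thesis by (simp add: H(1) rel_mk[OF H(2)] rel_mk[OF assms(2)])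
    qed
    moreover have "y \<in> n_marked_groups (length A)"
      using mk_in_n_marked_groups[OF H(2)] H(1,3) by simp
    ultimately show ?thesis unfolding rel_nbhd_def by auto
  qed
  then show ?thesis by blast
qed

lemma openin_n_marked_topology_iff:
  "openin (n_marked_topology n) U \<longleftrightarrow>
     U \<subseteq> n_marked_groups n \<and> (\<forall>x\<in>U. \<exists>F. finite F \<and> rel_nbhd n F x \<subseteq> U)"
proof (intro iffI conjI)
  assume U: "openin (n_marked_topology n) U"
  then show "U \<subseteq> n_marked_groups n"
    using openin_subset topspace_n_marked_topology by metis
  have "generate_topology_on {marked_nbhd r G A | r G A. marked G A \<and> length A = n} U"
    using U unfolding n_marked_topology_def openin_topology_generated_by_iff .
  then show "\<forall>x\<in>U. \<exists>F. finite F \<and> rel_nbhd n F x \<subseteq> U"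
  proof induction
    case (Int a b)
    show ?case
    proof
      fix x assume "x \<in> a \<inter> b"
      then obtain F F' where "finite F" "rel_nbhd n F x \<subseteq> a" "finite F'" "rel_nbhd n F' x \<subseteq> b"
        using Int.IH by blast
      then show "\<exists>F. finite F \<and> rel_nbhd n F x \<subseteq> a \<inter> b"
        by (intro exI[of _ "F \<union> F'"]) (auto simp: rel_nbhd_def subset_iff set_eq_iff)
    qed
  next
    case (UN K)
    then show ?case by (metis Union_iff Union_upper subset_trans)
  next
    case (Basis s)
    then obtain r G A where "s = marked_nbhd r G A" "marked G A" "length A = n" by auto
    then show ?case using rel_nbhd_subset_marked_nbhd by simp
  qed simp
next
  assume U: "U \<subseteq> n_marked_groups n \<and> (\<forall>x\<in>U. \<exists>F. finite F \<and> rel_nbhd n F x \<subseteq> U)"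
  show "openin (n_marked_topology n) U"
  proof (subst openin_subopen, intro ballI)
    fix x assume "x \<in> U"
    with U obtain F where F: "finite F" "rel_nbhd n F x \<subseteq> U" by blast
    from \<open>x \<in> U\<close> U have "x \<in> n_marked_groups n" by blast
    then obtain G A where x: "marked G A" "length A = n" "x = mk G A" by (rule n_marked_groupsE)
    obtain r where r: "marked_nbhd r G A \<subseteq> rel_nbhd n F x"
      using marked_nbhd_subset_rel_nbhd[OF F(1) x(1)] x(2,3) by auto
    have "openin (n_marked_topology n) (marked_nbhd r G A)"
      unfolding n_marked_topology_def using x(1,2) by (intro topology_generated_by_Basis) auto
    moreover have "x \<in> marked_nbhd r G A"
      unfolding x(3) by (rule marked_nbhdI[OF x(1) HOL.refl balls_iso_refl])
    ultimately show "\<exists>T. openin (n_marked_topology n) T \<and> x \<in> T \<and> T \<subseteq> U"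
      using r F(2) by (meson subset_trans)
  qed
qed

lemma open_rel_nbhd_subset:
  assumes "open U" "x \<in> U" "x \<in> n_marked_groups n"
  obtains F where "finite F" "rel_nbhd n F x \<subseteq> U"
proof -
  have "openin (n_marked_topology n) (U \<inter> n_marked_groups n)"
    using assms(1) unfolding open_marked_group_def by simp
  then have "\<exists>F. finite F \<and> rel_nbhd n F x \<subseteq> U \<inter> n_marked_groups n"
    using assms(2,3) unfolding openin_n_marked_topology_iff by simp
  then show thesis using that by auto
qed

text \<open>Openness in the union concerns the trace on every \<open>n_marked_groups m\<close>, yet
  one \<open>n\<close> per point is enough, because the part of \<open>n_marked_groups m\<close>
  lying in \<open>n_marked_groups n\<close> is open in it.\<close>

lemma open_rel_nbhdI:
  assumes "\<And>x. x \<in> U \<Longrightarrow> \<exists>n F. finite F \<and> x \<in> n_marked_groups n \<and> rel_nbhd n F x \<subseteq> U"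
  shows "open U"
  unfolding open_marked_group_def openin_n_marked_topology_iff
proof (intro allI conjI ballI)
  fix m x assume "x \<in> U \<inter> n_marked_groups m"
  then obtain n F where F: "finite F" "x \<in> n_marked_groups n" "rel_nbhd n F x \<subseteq> U"
    using assms[of x] by auto
  \<comment> \<open>The added pairs force a nearby point of \<open>n_marked_groups m\<close> into
    \<open>n_marked_groups n\<close>: its variables between \<open>n\<close> and \<open>m\<close>
    are trivial as they are for \<open>x\<close>, and those from \<open>m\<close> on are trivial by
    membership.\<close>
  define F' where "F' = F \<union> (\<lambda>i. (Var i, One)) ` {..<m}"
  have "y \<in> U \<inter> n_marked_groups m" if y: "y \<in> rel_nbhd m F' x" for y
  proof -
    have eq: "p \<in> rel y \<longleftrightarrow> p \<in> rel x" if "p \<in> F'" for p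
      using y that unfolding rel_nbhd_def by blast
    have "(Var i, One) \<in> rel y" if "n \<le> i" for i
      using that F(2) y eq[of "(Var i, One)"]
      by (cases "i < m") (auto simp: F'_def n_marked_groups_iff rel_nbhd_def)
    then have "y \<in> n_marked_groups n" by (simp add: n_marked_groups_iff)
    moreover have "rel y \<inter> F = rel x \<inter> F" using eq by (auto simp: F'_def)
    ultimately have "y \<in> U" using F(3) by (auto simp: rel_nbhd_def)
    then show ?thesis using y by (simp add: rel_nbhd_def)
  qed
  moreover have "finite F'" using F(1) by (simp add: F'_def)
  ultimately show "\<exists>F. finite F \<and> rel_nbhd m F x \<subseteq> U \<inter> n_marked_groups m" by blast
qed simp

lemma open_rel_nbhd: "finite F \<Longrightarrow> open (rel_nbhd n F x)"
proof (rule open_rel_nbhdI)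
  fix y assume "finite F" "y \<in> rel_nbhd n F x"
  moreover from this have "rel_nbhd n F y = rel_nbhd n F x" by (simp add: rel_nbhd_def)
  ultimately show "\<exists>n' F'. finite F' \<and> y \<in> n_marked_groups n' \<and> rel_nbhd n' F' y \<subseteq> rel_nbhd n F x"
    by (intro exI[of _ n] exI[of _ F]) (simp add: rel_nbhd_def)
qed

text \<open>Basic open sets described by finite data without a centre. Lists make the index type
  countable, as the category argument needs, and can be written into a sentence.\<close>

definition cylinder ::
  "nat \<Rightarrow> (gterm \<times> gterm) list \<Rightarrow> (gterm \<times> gterm) list \<Rightarrow> marked_group set" where
  "cylinder n L L' = {x \<in> n_marked_groups n. set L \<subseteq> rel x \<and> set L' \<inter> rel x = {}}"

lemma open_cylinder: "open (cylinder n L L')"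
proof (rule open_rel_nbhdI)
  fix x assume "x \<in> cylinder n L L'"
  then show "\<exists>m F. finite F \<and> x \<in> n_marked_groups m \<and> rel_nbhd m F x \<subseteq> cylinder n L L'"
    by (intro exI[of _ n] exI[of _ "set L \<union> set L'"]) (auto simp: cylinder_def rel_nbhd_def)
qed

lemma cylinder_basis:
  assumes "open U" "x \<in> U"
  obtains n L L' where "x \<in> cylinder n L L'" "cylinder n L L' \<subseteq> U"
proof -
  obtain n where n: "x \<in> n_marked_groups n" using ex_n_marked_groups by blast
  obtain F where F: "finite F" "rel_nbhd n F x \<subseteq> U"
    using open_rel_nbhd_subset[OF assms n] .
  obtain L L' where L: "set L = F \<inter> rel x" "set L' = F - rel x"
    using F(1) finite_list by (metis finite_Diff finite_Int)
  have "x \<in> cylinder n L L'" using n L by (auto simp: cylinder_def)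
  moreover have "cylinder n L L' \<subseteq> rel_nbhd n F x"
    unfolding cylinder_def rel_nbhd_def L by auto
  ultimately show thesis using F(2) that by blast
qed

section \<open>Baire category\<close>

text \<open>Shrinking open sets to avoid \<open>N\<close> is the form that fits both the nested
  construction in the category theorem and the transport along partial homeomorphisms.\<close>

lemma nowhere_dense_in_iff:
  "nowhere_dense_in X N \<longleftrightarrow> N \<subseteq> topspace X \<and>
     (\<forall>U. openin X U \<and> U \<noteq> {} \<longrightarrow> (\<exists>V. openin X V \<and> V \<noteq> {} \<and> V \<subseteq> U \<and> V \<inter> N = {}))"
proof (intro iffI conjI allI impI)
  assume N: "nowhere_dense_in X N"
  then show "N \<subseteq> topspace X" by (simp add: nowhere_dense_in_def)
  fix U assume U: "openin X U \<and> U \<noteq> {}"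
  have "\<not> U \<subseteq> X closure_of N"
    using U N interior_of_maximal[of U "X closure_of N" X] by (auto simp: nowhere_dense_in_def)
  moreover have "openin X (U - X closure_of N)" using U by (simp add: openin_diff)
  moreover have "N \<subseteq> X closure_of N"
    using \<open>N \<subseteq> topspace X\<close> by (rule closure_of_subset)
  ultimately show "\<exists>V. openin X V \<and> V \<noteq> {} \<and> V \<subseteq> U \<and> V \<inter> N = {}"
    by (intro exI[of _ "U - X closure_of N"]) auto
next
  assume N: "N \<subseteq> topspace X \<and>
     (\<forall>U. openin X U \<and> U \<noteq> {} \<longrightarrow> (\<exists>V. openin X V \<and> V \<noteq> {} \<and> V \<subseteq> U \<and> V \<inter> N = {}))"
  have "X interior_of (X closure_of N) = {}"
  proof (rule ccontr)
    assume "X interior_of (X closure_of N) \<noteq> {}"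
    with N have "\<exists>V. openin X V \<and> V \<noteq> {} \<and> V \<subseteq> (X interior_of (X closure_of N)) \<and> V \<inter> N = {}"
      by (metis openin_interior_of)
    then obtain V where V: "openin X V" "V \<noteq> {}" "V \<subseteq> (X interior_of (X closure_of N))"
      "V \<inter> N = {}" by auto
    from V(2) obtain x where "x \<in> V" by auto
    then have "x \<in> X closure_of N" using V(3) interior_of_subset[of X "X closure_of N"] by auto
    note \<open>x \<in> V\<close> this
    with V show False by (auto simp: in_closure_of)
  qed
  with N show "nowhere_dense_in X N" by (simp add: nowhere_dense_in_def)
qed

lemma nowhere_dense_in_subset: "nowhere_dense_in X N \<Longrightarrow> M \<subseteq> N \<Longrightarrow> nowhere_dense_in X M"
  unfolding nowhere_dense_in_iff
proof (elim conjE, intro conjI allI impI)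
  fix U assume "M \<subseteq> N" and U: "openin X U \<and> U \<noteq> {}"
    and "\<forall>U. openin X U \<and> U \<noteq> {} \<longrightarrow> (\<exists>V. openin X V \<and> V \<noteq> {} \<and> V \<subseteq> U \<and> V \<inter> N = {})"
  then obtain V where "openin X V" "V \<noteq> {}" "V \<subseteq> U" "V \<inter> N = {}" by (elim allE[of _ U]) auto
  with \<open>M \<subseteq> N\<close> show "\<exists>V. openin X V \<and> V \<noteq> {} \<and> V \<subseteq> U \<and> V \<inter> M = {}"
    by (intro exI[of _ V]) auto
qed auto

lemma nowhere_dense_in_boundary:
  assumes "openin X U" shows "nowhere_dense_in X (X closure_of U - U)"
  unfolding nowhere_dense_in_iff
proof (intro conjI allI impI)
  show "X closure_of U - U \<subseteq> topspace X" using closure_of_subset_topspace by fastforce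
  fix W assume W: "openin X W \<and> W \<noteq> {}"
  show "\<exists>V. openin X V \<and> V \<noteq> {} \<and> V \<subseteq> W \<and> V \<inter> (X closure_of U - U) = {}"
  proof (cases "W \<inter> U = {}")
    case True
    then have "W \<inter> (X closure_of U) = {}" using W openin_Int_closure_of_eq_empty by metis
    then show ?thesis using W by (intro exI[of _ W]) auto
  next
    case False
    then show ?thesis using W assms by (intro exI[of _ "W \<inter> U"]) (auto simp: openin_Int)
  qed
qed

lemma nowhere_dense_imp_meager: "nowhere_dense_in X N \<Longrightarrow> meager_in X N"
  unfolding meager_in_def by (intro exI[of _ "{N}"]) auto

lemma meager_in_subset:
  assumes "meager_in X M" "N \<subseteq> M" shows "meager_in X N"
proof -
  from assms(1) obtain \<N> where N: "countable \<N>" "\<forall>A\<in>\<N>. nowhere_dense_in X A" "M = \<Union>\<N>"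
    unfolding meager_in_def by blast
  show ?thesis
    unfolding meager_in_def
  proof (intro exI conjI)
    show "countable ((\<lambda>A. A \<inter> N) ` \<N>)" using N(1) by simp
    show "\<forall>A\<in>(\<lambda>A. A \<inter> N) ` \<N>. nowhere_dense_in X A"
      using N(2) nowhere_dense_in_subset by blast
    show "N = \<Union>((\<lambda>A. A \<inter> N) ` \<N>)" using N(3) assms(2) by blast
  qed
qed

lemma meager_in_empty: "meager_in X {}"
  unfolding meager_in_def by (intro exI[of _ "{}"]) simp

lemma meager_in_UN:
  assumes "\<And>k::nat. meager_in X (M k)" shows "meager_in X (\<Union>k. M k)"
proof -
  from assms have "\<forall>k. \<exists>\<N>. countable \<N> \<and> (\<forall>A\<in>\<N>. nowhere_dense_in X A) \<and> M k = \<Union>\<N>"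
    unfolding meager_in_def by blast
  then obtain \<N> where
    "\<forall>k. countable (\<N> k) \<and> (\<forall>A\<in>\<N> k. nowhere_dense_in X A) \<and> M k = \<Union>(\<N> k)"
    by (rule choice[THEN exE])
  then show ?thesis
    unfolding meager_in_def by (intro exI[of _ "\<Union>k. \<N> k"]) auto
qed

lemma meager_in_Un:
  assumes "meager_in X M" "meager_in X N" shows "meager_in X (M \<union> N)"
proof -
  have "M \<union> N = (\<Union>k::nat. if k = 0 then M else N)" by (auto split: if_splits)
  moreover have "meager_in X (\<Union>k::nat. if k = 0 then M else N)"
    using assms by (intro meager_in_UN) auto
  ultimately show ?thesis by simp
qed

section \<open>The Baire property and the category theorem\<close>

definition baire_property :: "'a topology \<Rightarrow> 'a set \<Rightarrow> bool" where
  "baire_property X M \<longleftrightarrow> (\<exists>U. openin X U \<and> meager_in X (M - U) \<and> meager_in X (U - M))"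

lemma baire_property_openin: "openin X U \<Longrightarrow> baire_property X U"
  unfolding baire_property_def by (intro exI[of _ U]) (simp add: meager_in_empty)

lemma baire_property_compl:
  assumes "baire_property X M" shows "baire_property X (topspace X - M)"
proof -
  from assms obtain U where U: "openin X U" "meager_in X (M - U)" "meager_in X (U - M)"
    unfolding baire_property_def by blast
  \<comment> \<open>The exterior of \<open>U\<close> approximates the complement of
    \<open>M\<close>; besides the meager errors of \<open>U\<close> this costs only the boundary of
    \<open>U\<close>, which is nowhere dense.\<close>
  let ?V = "topspace X - (X closure_of U)"
  have "U \<subseteq> X closure_of U" using U(1) by (simp add: closure_of_subset openin_subset)
  then have sub: "(topspace X - M) - ?V \<subseteq> (X closure_of U - U) \<union> (U - M)"
    "?V - (topspace X - M) \<subseteq> M - U"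
    by auto
  have "meager_in X ((X closure_of U - U) \<union> (U - M))"
    using U by (intro meager_in_Un U(3) nowhere_dense_imp_meager[OF nowhere_dense_in_boundary])
  moreover have "openin X ?V" by (simp add: openin_diff)
  ultimately show ?thesis
    unfolding baire_property_def
    using meager_in_subset[OF _ sub(1)] meager_in_subset[OF U(2) sub(2)] by (intro exI[of _ ?V]) simp
qed

lemma baire_property_UN:
  assumes "\<And>k::nat. baire_property X (M k)" shows "baire_property X (\<Union>k. M k)"
proof -
  from assms have "\<forall>k. \<exists>U. openin X U \<and> meager_in X (M k - U) \<and> meager_in X (U - M k)"
    unfolding baire_property_def by blast
  then obtain U where U:
    "\<forall>k. openin X (U k) \<and> meager_in X (M k - U k) \<and> meager_in X (U k - M k)"
    by (rule choice[THEN exE])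
  show ?thesis
    unfolding baire_property_def
  proof (intro exI conjI)
    show "openin X (\<Union>k. U k)" using U by (intro openin_Union) auto
    show "meager_in X ((\<Union>k. M k) - (\<Union>k. U k))"
      by (rule meager_in_subset[OF meager_in_UN[of X "\<lambda>k. M k - U k"]]) (use U in auto)
    show "meager_in X ((\<Union>k. U k) - (\<Union>k. M k))"
      by (rule meager_in_subset[OF meager_in_UN[of X "\<lambda>k. U k - M k"]]) (use U in auto)
  qed
qed

lemma baire_property_INT:
  assumes "\<And>k::nat. baire_property X (M k)"
  shows "baire_property X (topspace X \<inter> (\<Inter>k. M k))"
proof -
  have "topspace X \<inter> (\<Inter>k. M k) = topspace X - (\<Union>k. topspace X - M k)" by auto
  moreover have "baire_property X (topspace X - (\<Union>k. topspace X - M k))"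
    by (intro baire_property_compl baire_property_UN assms)
  ultimately show ?thesis by simp
qed

text \<open>The Baire category theorem for \<open>S\<close>. Nested sets
  \<open>rel_nbhd n (F k) (x k)\<close> avoid the nowhere dense sets in turn while their windows
  come to contain every pair of terms. The decided pairs form a limit, which
  \<open>rel_complete\<close> realises by a point; \<open>n\<close> stays fixed throughout for that
  purpose.\<close>

lemma openin_meager_empty:
  fixes S :: "marked_group set"
  assumes "closed S" "openin (top_of_set S) W" "meager_in (top_of_set S) W"
  shows "W = {}"
proof (rule ccontr)
  let ?X = "top_of_set S"
  assume "W \<noteq> {}"
  then obtain x0 where "x0 \<in> W" by blast
  obtain T where T: "open T" "W = S \<inter> T" using assms(2) by (auto simp: openin_open)
  obtain n where "x0 \<in> n_marked_groups n" using ex_n_marked_groups by blast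
  have "x0 \<in> T" "x0 \<in> S" using \<open>x0 \<in> W\<close> T by auto
  obtain F0 where F0: "finite F0" "rel_nbhd n F0 x0 \<subseteq> T"
    using open_rel_nbhd_subset[OF T(1) \<open>x0 \<in> T\<close> \<open>x0 \<in> n_marked_groups n\<close>] .
  from assms(3) obtain \<N> where \<N>: "countable \<N>" "\<forall>A\<in>\<N>. nowhere_dense_in ?X A" "W = \<Union>\<N>"
    unfolding meager_in_def by blast
  have "\<N> \<noteq> {}" using \<N>(3) \<open>x0 \<in> W\<close> by blast
  then obtain N :: "nat \<Rightarrow> marked_group set" where N: "range N = \<N>"
    using \<N>(1) by (metis range_from_nat_into)
  define P where "P = (\<lambda>(k::nat) (x, F). x \<in> S \<inter> n_marked_groups n \<and> finite F \<and> rel_nbhd n F x \<inter> S \<subseteq> W)"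
  \<comment> \<open>The condition \<open>from_nat k \<in> F'\<close> feeds in the pairs of terms one
    by one, so that the windows exhaust them.\<close>
  define Q where "Q = (\<lambda>k (x, F) (x', F'). F \<subseteq> F' \<and> from_nat k \<in> F' \<and> rel x' \<inter> F = rel x \<inter> F
      \<and> rel_nbhd n F' x' \<inter> S \<inter> N k = {})"
  have "P 0 (x0, F0)"
    unfolding P_def using F0 T \<open>x0 \<in> S\<close> \<open>x0 \<in> n_marked_groups n\<close> by auto
  moreover have "\<exists>y. P (Suc k) y \<and> Q k xF y" if "P k xF" for k xF
  proof -
    obtain x F where xF: "xF = (x, F)" by (cases xF)
    with that have x: "x \<in> S" "x \<in> n_marked_groups n" "finite F" "rel_nbhd n F x \<inter> S \<subseteq> W"
      by (auto simp: P_def)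
    have "openin ?X (S \<inter> rel_nbhd n F x)"
      using open_rel_nbhd[OF x(3)] by (rule openin_open_Int)
    moreover have "x \<in> S \<inter> rel_nbhd n F x" using x by (simp add: rel_nbhd_def)
    moreover have "nowhere_dense_in ?X (N k)" using \<N>(2) N by blast
    ultimately obtain V where V: "openin ?X V" "V \<noteq> {}" "V \<subseteq> S \<inter> rel_nbhd n F x" "V \<inter> N k = {}"
      unfolding nowhere_dense_in_iff by (metis empty_iff)
    then obtain x' where x': "x' \<in> V" by blast
    obtain T' where T': "open T'" "V = S \<inter> T'" using V(1) by (auto simp: openin_open)
    have "x' \<in> T'" "x' \<in> S" "x' \<in> rel_nbhd n F x" using x' V(3) T'(2) by auto
    then have n': "x' \<in> n_marked_groups n" by (simp add: rel_nbhd_def)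
    obtain F'' where F'': "finite F''" "rel_nbhd n F'' x' \<subseteq> T'"
      using open_rel_nbhd_subset[OF T'(1) \<open>x' \<in> T'\<close> n'] .
    define F' where "F' = F \<union> F'' \<union> {from_nat k}"
    have sub: "rel_nbhd n F' x' \<subseteq> rel_nbhd n F x' \<inter> rel_nbhd n F'' x'"
      unfolding rel_nbhd_def F'_def by blast
    have "rel x' \<inter> F = rel x \<inter> F" using \<open>x' \<in> rel_nbhd n F x\<close> by (simp add: rel_nbhd_def)
    then have "rel_nbhd n F x' = rel_nbhd n F x" by (simp add: rel_nbhd_def)
    with sub x(4) have "rel_nbhd n F' x' \<inter> S \<subseteq> W" by blast
    then have "P (Suc k) (x', F')"
      using \<open>x' \<in> S\<close> n' x(3) F''(1) by (simp add: P_def F'_def)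
    moreover have "rel_nbhd n F' x' \<inter> S \<inter> N k = {}"
      using sub F''(2) T'(2) V(4) by blast
    then have "Q k xF (x', F')"
      using \<open>rel x' \<inter> F = rel x \<inter> F\<close> by (simp add: Q_def xF F'_def subset_iff)
    ultimately show ?thesis by blast
  qed
  ultimately obtain f where f: "\<And>k. P k (f k)" "\<And>k. Q k (f k) (f (Suc k))"
    using dependent_nat_choice[of P Q] by (metis (no_types, lifting))
  define x where "x k = fst (f k)" for k
  define F where "F k = snd (f k)" for k
  have x: "x k \<in> S" "x k \<in> n_marked_groups n" "finite (F k)" "rel_nbhd n (F k) (x k) \<inter> S \<subseteq> W" for k
    using f(1)[of k] by (auto simp: P_def x_def F_def split: prod.splits)
  have step: "F k \<subseteq> F (Suc k)" "from_nat k \<in> F (Suc k)" "rel (x (Suc k)) \<inter> F k = rel (x k) \<inter> F k"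
    "rel_nbhd n (F (Suc k)) (x (Suc k)) \<inter> S \<inter> N k = {}" for k
    using f(2)[of k] by (auto simp: Q_def x_def F_def split: prod.splits)
  note stable = step(3)
  have mono: "F j \<subseteq> F k" if "j \<le> k" for j k
    using lift_Suc_mono_le[of F, OF step(1) that] .
  have const: "rel (x k) \<inter> F j = rel (x j) \<inter> F j" if "j \<le> k" for j k
    using that
  proof (induction rule: dec_induct)
    case (step k)
    then show ?case using mono[of j k] stable[of k] by blast
  qed simp
  \<comment> \<open>Stage \<open>k\<close> decides the pairs in \<open>F k\<close>, and by
    \<open>const\<close> later stages agree with it; \<open>K\<close> gathers the pairs decided
    positively.\<close>
  define K where "K = {p. \<exists>k. p \<in> F k \<inter> rel (x k)}"
  have K: "K \<inter> F k = rel (x k) \<inter> F k" for k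
  proof -
    have "p \<in> rel (x k)" if "p \<in> F k" "p \<in> F j" "p \<in> rel (x j)" for p j
      using that const[of j k] const[of k j] by (cases "j \<le> k") auto
    then show ?thesis unfolding K_def by blast
  qed
  have exhaust: "\<exists>k. A \<subseteq> F k" if "finite A" for A
  proof -
    have "finite (to_nat ` A)" using that by simp
    then obtain m where m: "\<forall>i\<in>to_nat ` A. i \<le> m" unfolding finite_nat_set_iff_bounded_le by auto
    have "p \<in> F (Suc m)" if "p \<in> A" for p
      using step(2)[of "to_nat p"] mono[of "Suc (to_nat p)" "Suc m"] m that by auto
    then show ?thesis by blast
  qed
  have "\<exists>y\<in>n_marked_groups n. rel y = K"
  proof (rule rel_complete)
    fix A :: "(gterm \<times> gterm) set" assume "finite A"
    then obtain k where "A \<subseteq> F k" using exhaust by blast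
    then have "rel (x k) \<inter> A = K \<inter> A" using K[of k] by blast
    then show "\<exists>y\<in>n_marked_groups n. rel y \<inter> A = K \<inter> A" using x(2) by blast
  qed
  then obtain y where y: "y \<in> n_marked_groups n" "rel y = K" by blast
  then have nbhd: "y \<in> rel_nbhd n (F k) (x k)" for k by (simp add: rel_nbhd_def K)
  \<comment> \<open>A neighbourhood of \<open>y\<close> outside \<open>S\<close> would be given by a
    finite window. Once \<open>F k\<close> covers this window, \<open>x k\<close> lies in that
    neighbourhood, but also in \<open>S\<close>.\<close>
  have "y \<in> S"
  proof (rule ccontr)
    assume "y \<notin> S"
    then have "open (- S)" "y \<in> - S" using assms(1) by auto
    then obtain A where A: "finite A" "rel_nbhd n A y \<subseteq> - S"
      using open_rel_nbhd_subset y(1) by blast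
    then obtain k where "A \<subseteq> F k" using exhaust by blast
    then have "x k \<in> rel_nbhd n A y"
      using nbhd[of k] x(2)[of k] unfolding rel_nbhd_def by blast
    with A(2) x(1)[of k] show False by blast
  qed
  then have "y \<in> W" using x(4)[of 0] nbhd[of 0] by blast
  moreover have "y \<notin> N k" for k using step(4)[of k] nbhd[of "Suc k"] \<open>y \<in> S\<close> by blast
  ultimately show False using \<N>(3) N by blast
qed

section \<open>Changing the marking\<close>

primrec subst :: "(nat \<Rightarrow> gterm) \<Rightarrow> gterm \<Rightarrow> gterm" where
  "subst v (Var i) = v i"
| "subst v One = One"
| "subst v (Mult s t) = Mult (subst v s) (subst v t)"
| "subst v (Inv t) = Inv (subst v t)"

lemma term_val_subst: "term_val G e (subst v t) = term_val G (\<lambda>i. term_val G e (v i)) t"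
  by (induction t) auto

text \<open>For \<open>v\<close> eventually \<open>One\<close>, the values of \<open>v\<close> in
  \<open>x\<close> become the new generators. In general they generate only a subgroup, which is
  then the group of the new point. Pulling relations back along \<open>subst v\<close> specifies the
  point without a choice of representative.\<close>

definition change_marking :: "(nat \<Rightarrow> gterm) \<Rightarrow> marked_group \<Rightarrow> marked_group" where
  "change_marking v x = (SOME y. rel y = {(s, t). (subst v s, subst v t) \<in> rel x})"

lemma rel_change_marking:
  assumes "\<And>j. j \<ge> m \<Longrightarrow> v j = One"
  shows "rel (change_marking v x) = {(s, t). (subst v s, subst v t) \<in> rel x}"
proof -
  interpret group_congruence "rel x" by (rule group_congruence_rel)
  have "group_congruence {(s, t). (subst v s, subst v t) \<in> rel x}"
    by (rule group_congruence.intro)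
      (auto simp: refl Mult_cong Inv_cong assoc One_left Inv_left intro: sym elim: trans)
  then have "\<exists>y. rel y = {(s, t). (subst v s, subst v t) \<in> rel x}"
    by (rule group_congruence.ex_rel[of _ m]) (simp add: assms refl)
  then show ?thesis unfolding change_marking_def by (rule someI_ex)
qed

lemma change_marking_in_n_marked_groups:
  assumes "\<And>j. j \<ge> m \<Longrightarrow> v j = One"
  shows "change_marking v x \<in> n_marked_groups m"
proof -
  interpret group_congruence "rel x" by (rule group_congruence_rel)
  show ?thesis
    by (simp add: n_marked_groups_iff rel_change_marking[of m v, OF assms] assms refl)
qed

text \<open>Each pair in the new relations is decided by a single pair in the old ones, so a finite
  window at the image pulls back to a finite window at the point.\<close>

lemma open_vimage_change_marking:
  assumes v: "\<And>j. j \<ge> m \<Longrightarrow> v j = One" and "open U"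
  shows "open {x. change_marking v x \<in> U}"
proof (rule open_rel_nbhdI)
  fix x assume "x \<in> {x. change_marking v x \<in> U}"
  then have x: "change_marking v x \<in> U" by simp
  obtain n where n: "x \<in> n_marked_groups n" using ex_n_marked_groups by blast
  have rel: "rel (change_marking v z) = {(s, t). (subst v s, subst v t) \<in> rel z}" for z
    by (rule rel_change_marking[of m]) (rule v)
  have in_m: "change_marking v z \<in> n_marked_groups m" for z
    by (rule change_marking_in_n_marked_groups) (rule v)
  obtain F where F: "finite F" "rel_nbhd m F (change_marking v x) \<subseteq> U"
    using open_rel_nbhd_subset[OF assms(2) x in_m] .
  let ?F = "map_prod (subst v) (subst v) ` F"
  have "rel_nbhd n ?F x \<subseteq> {x. change_marking v x \<in> U}"
  proof
    fix y assume "y \<in> rel_nbhd n ?F x"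
    then have "p \<in> rel y \<longleftrightarrow> p \<in> rel x" if "p \<in> ?F" for p
      using that unfolding rel_nbhd_def by blast
    then have "(subst v s, subst v t) \<in> rel y \<longleftrightarrow> (subst v s, subst v t) \<in> rel x" if "(s, t) \<in> F" for s t
      using that by force
    then have "rel (change_marking v y) \<inter> F = rel (change_marking v x) \<inter> F"
      unfolding rel by auto
    then show "y \<in> {x. change_marking v x \<in> U}"
      using F(2) in_m by (auto simp: rel_nbhd_def)
  qed
  then show "\<exists>n F. finite F \<and> x \<in> n_marked_groups n \<and> rel_nbhd n F x \<subseteq> {x. change_marking v x \<in> U}"
    using n F(1) by blast
qed

text \<open>Literally one \<open>G\<close> carries both markings, so the terms of both can be
  evaluated side by side; \<open>iso_class_same_group\<close> reduces isomorphic groups to this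
  case.\<close>

definition same_group :: "marked_group \<Rightarrow> marked_group \<Rightarrow> bool" where
  "same_group x y \<longleftrightarrow> (\<exists>G A B. marked G A \<and> marked G B \<and> x = mk G A \<and> y = mk G B)"

lemma same_group_sym: "same_group x y \<Longrightarrow> same_group y x"
  unfolding same_group_def by auto

text \<open>On this set the tuple given by \<open>v\<close> generates the same group, as \<open>w\<close> recovers the original
  generators from it.\<close>

definition change_domain ::
  "(nat \<Rightarrow> gterm) \<Rightarrow> (nat \<Rightarrow> gterm) \<Rightarrow> nat \<Rightarrow> marked_group set" where
  "change_domain v w n = {x \<in> n_marked_groups n. \<forall>i. (Var i, subst v (w i)) \<in> rel x}"

text \<open>The defining equations come down to those with \<open>i < n\<close>: from
  \<open>n\<close> on, \<open>w i\<close> is \<open>One\<close> and \<open>Var i\<close> is trivial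
  in \<open>n_marked_groups n\<close>. So a finite window suffices.\<close>

lemma open_change_domain:
  assumes "\<And>i. i \<ge> n \<Longrightarrow> w i = One"
  shows "open (change_domain v w n)"
proof (rule open_rel_nbhdI)
  let ?F = "(\<lambda>i. (Var i, subst v (w i))) ` {..<n}"
  fix x assume x: "x \<in> change_domain v w n"
  have "rel_nbhd n ?F x \<subseteq> change_domain v w n"
  proof
    fix y assume y: "y \<in> rel_nbhd n ?F x"
    then have *: "p \<in> rel y \<longleftrightarrow> p \<in> rel x" if "p \<in> ?F" for p
      using that unfolding rel_nbhd_def by blast
    have "(Var i, subst v (w i)) \<in> rel y" for i
    proof (cases "i < n")
      case True
      then show ?thesis using *[of "(Var i, subst v (w i))"] x by (auto simp: change_domain_def)
    next
      case False
      then show ?thesis using y assms by (simp add: rel_nbhd_def n_marked_groups_iff)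
    qed
    then show "y \<in> change_domain v w n" using y by (simp add: change_domain_def rel_nbhd_def)
  qed
  moreover have "finite ?F" "x \<in> n_marked_groups n" using x by (simp_all add: change_domain_def)
  ultimately show "\<exists>m F. finite F \<and> x \<in> n_marked_groups m \<and> rel_nbhd m F x \<subseteq> change_domain v w n"
    by blast
qed

text \<open>Evaluating a term under the new tuple means substituting \<open>v\<close> and evaluating
  under the old one. The equations of the domain make \<open>subst v\<close> after
  \<open>subst w\<close> preserve values, so the new tuple generates the same group and
  \<open>w\<close> recovers the old marking.\<close>

lemma change_marking_inverse:
  assumes v: "\<And>j. j \<ge> m \<Longrightarrow> v j = One" and w: "\<And>i. i \<ge> n \<Longrightarrow> w i = One"
    and x: "x \<in> change_domain v w n"
  shows "change_marking v x \<in> change_domain w v m"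
    and "change_marking w (change_marking v x) = x"
    and "same_group x (change_marking v x)"
proof -
  obtain G A where G: "marked G A" "x = mk G A" using ex_mk by blast
  note g = marked_group[OF G(1)] marked_subset[OF G(1)]
  interpret group G by (rule g)
  have "tval G A (subst v (w i)) = marking_env G A i" for i
    using x by (simp add: change_domain_def G(2) rel_mk[OF G(1)])
  then have vw: "tval G A (subst v (subst w t)) = tval G A t" for t
    by (induction t) simp_all
  define B where "B = map (\<lambda>j. tval G A (v j)) [0..<m]"
  have "marking_env G B = (\<lambda>j. tval G A (v j))"
    by (auto simp: marking_env_def B_def v)
  then have tvB: "tval G B t = tval G A (subst v t)" for t
    by (simp add: term_val_subst)
  have "set B \<subseteq> carrier G" using tval_closed[OF g] by (auto simp: B_def)
  moreover have "carrier G \<subseteq> range (tval G B)"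
  proof
    fix a assume "a \<in> carrier G"
    then obtain t where "a = tval G A t" using marked_carrier[OF G(1)] by auto
    then have "a = tval G B (subst w t)" by (simp only: tvB vw)
    then show "a \<in> range (tval G B)" by simp
  qed
  ultimately have B: "marked G B" unfolding marked_iff_range_tval using g by simp
  have y: "change_marking v x = mk G B"
    by (rule rel_inj, subst rel_change_marking[of m v], erule v)
      (simp_all add: G(2) rel_mk[OF G(1)] rel_mk[OF B] tvB)
  show "same_group x (change_marking v x)"
    unfolding same_group_def y using G B by auto
  have "tval G B (subst w (v j)) = tval G B (Var j)" for j
    by (simp only: tvB vw subst.simps)
  then have "(Var j, subst w (v j)) \<in> rel (mk G B)" for j by (simp add: rel_mk[OF B])
  then show "change_marking v x \<in> change_domain w v m"
    using change_marking_in_n_marked_groups[of m v x, OF v] unfolding change_domain_def y by simp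
  show "change_marking w (change_marking v x) = x"
    by (rule rel_inj, subst rel_change_marking[of n w], erule w)
      (simp_all add: y[unfolded G(2)] G(2) rel_mk[OF G(1)] rel_mk[OF B] tvB vw)
qed

lemma ex_change_marking:
  assumes "marked G A" "marked G B"
  obtains v w m n where "\<And>j. j \<ge> m \<Longrightarrow> v j = One" "\<And>i. i \<ge> n \<Longrightarrow> w i = One"
    "mk G A \<in> change_domain v w n" "change_marking v (mk G A) = mk G B"
proof -
  have ex: "\<exists>v. (\<forall>j\<ge>length D. v j = One) \<and> (\<forall>j. tval G C (v j) = marking_env G D j)"
    if C: "marked G C" and D: "marked G D" for C D
  proof -
    have "\<exists>t. (j \<ge> length D \<longrightarrow> t = One) \<and> tval G C t = marking_env G D j" for j
    proof (cases "j < length D")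
      case True
      have "marking_env G D j \<in> carrier G"
        by (intro marking_env_closed marked_group[OF D] marked_subset[OF D])
      then obtain t where "marking_env G D j = tval G C t"
        unfolding marked_carrier[OF C] by auto
      then show ?thesis using True by (intro exI[of _ t]) simp
    next
      case False
      then show ?thesis by (intro exI[of _ One]) (simp add: marking_env_def)
    qed
    then show ?thesis by metis
  qed
  obtain v where v: "\<And>j. j \<ge> length B \<Longrightarrow> v j = One" "\<And>j. tval G A (v j) = marking_env G B j"
    using ex[OF assms] by blast
  obtain w where w: "\<And>i. i \<ge> length A \<Longrightarrow> w i = One" "\<And>i. tval G B (w i) = marking_env G A i"
    using ex[OF assms(2,1)] by blast
  have tv: "tval G A (subst v t) = tval G B t" for t
    by (simp add: term_val_subst v(2))
  have "(Var i, subst v (w i)) \<in> rel (mk G A)" for i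
    by (simp add: rel_mk[OF assms(1)] tv w(2))
  then have "mk G A \<in> change_domain v w (length A)"
    using mk_in_n_marked_groups[OF assms(1)] by (simp add: change_domain_def)
  moreover have "change_marking v (mk G A) = mk G B"
    by (rule rel_inj, subst rel_change_marking[of "length B" v], erule v(1))
      (simp_all add: rel_mk[OF assms(1)] rel_mk[OF assms(2)] tv)
  ultimately show thesis using that v(1) w(1) by metis
qed

text \<open>An open set meeting \<open>D\<close> is carried into \<open>E\<close> by the inverse
  map, shrunk there to avoid \<open>N\<close>, and carried back; one disjoint from \<open>D\<close>
  avoids the preimage already.\<close>

lemma nowhere_dense_in_vimage:
  assumes D: "openin X D"
    and \<phi>: "\<And>U. openin X U \<Longrightarrow> openin X {x \<in> D. \<phi> x \<in> U}"
    and \<psi>: "\<And>U. openin X U \<Longrightarrow> openin X {y \<in> E. \<psi> y \<in> U}"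
    and DE: "\<And>x. x \<in> D \<Longrightarrow> \<phi> x \<in> E \<and> \<psi> (\<phi> x) = x"
    and ED: "\<And>y. y \<in> E \<Longrightarrow> \<psi> y \<in> D \<and> \<phi> (\<psi> y) = y"
    and N: "nowhere_dense_in X N"
  shows "nowhere_dense_in X {x \<in> D. \<phi> x \<in> N}"
  unfolding nowhere_dense_in_iff
proof (intro conjI allI impI)
  show "{x \<in> D. \<phi> x \<in> N} \<subseteq> topspace X" using openin_subset[OF D] by auto
  fix U assume U: "openin X U \<and> U \<noteq> {}"
  show "\<exists>V. openin X V \<and> V \<noteq> {} \<and> V \<subseteq> U \<and> V \<inter> {x \<in> D. \<phi> x \<in> N} = {}"
  proof (cases "U \<inter> D = {}")
    case True
    then show ?thesis using U by (intro exI[of _ U]) auto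
  next
    case False
    then obtain x where x: "x \<in> U" "x \<in> D" by auto
    let ?U = "{y \<in> E. \<psi> y \<in> U}"
    have "openin X ?U \<and> ?U \<noteq> {}" using \<psi>[of U] U DE[OF x(2)] x(1) by auto
    then obtain V where V: "openin X V" "V \<noteq> {}" "V \<subseteq> ?U" "V \<inter> N = {}"
      using N[unfolded nowhere_dense_in_iff] by (metis (no_types, lifting))
    from V(2) obtain y where "y \<in> V" by auto
    with V(3) ED have "\<psi> y \<in> {x \<in> D. \<phi> x \<in> V}" by auto
    then have "{x \<in> D. \<phi> x \<in> V} \<noteq> {}" by auto
    moreover have "{x \<in> D. \<phi> x \<in> V} \<subseteq> U" using V(3) DE by auto
    moreover have "{x \<in> D. \<phi> x \<in> V} \<inter> {x \<in> D. \<phi> x \<in> N} = {}" using V(4) by auto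
    ultimately show ?thesis using \<phi>[OF V(1)] by (intro exI[of _ "{x \<in> D. \<phi> x \<in> V}"]) simp
  qed
qed

lemma same_group_closed:
  assumes "iso_invariant S" "same_group x y" "x \<in> S" shows "y \<in> S"
proof -
  obtain G A B where G: "marked G A" "marked G B" "x = mk G A" "y = mk G B"
    using assms(2) unfolding same_group_def by auto
  have "iso_class G \<subseteq> S"
    using assms(1,3) G(1,3) unfolding iso_invariant_def by auto
  moreover have "mk G B \<in> iso_class G"
    unfolding iso_class_def by (intro CollectI exI conjI) (rule HOL.refl G iso_refl)+
  ultimately show ?thesis using G(4) by auto
qed

text \<open>Both changes of marking keep the group and hence preserve \<open>S\<close>, so they
  restrict to mutually inverse homeomorphisms between relatively open subsets of
  \<open>S\<close>.\<close>

lemma meager_in_vimage_change_marking: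
  assumes S: "iso_invariant S"
    and v: "\<And>j. j \<ge> m \<Longrightarrow> v j = One" and w: "\<And>i. i \<ge> n \<Longrightarrow> w i = One"
    and M: "meager_in (top_of_set S) M"
  shows "meager_in (top_of_set S) {x \<in> S \<inter> change_domain v w n. change_marking v x \<in> M}"
proof -
  let ?X = "top_of_set S"
  let ?P = "\<lambda>N. {x \<in> S \<inter> change_domain v w n. change_marking v x \<in> N}"
  have closed: "change_marking v' x \<in> S"
    if "x \<in> S" "x \<in> change_domain v' w' n'" "\<And>j. j \<ge> m' \<Longrightarrow> v' j = One" "\<And>j. j \<ge> n' \<Longrightarrow> w' j = One"
    for x v' w' m' n'
    using same_group_closed[OF S change_marking_inverse(3)[of m' v' n' w' x]] that by metis
  have op: "openin ?X {x \<in> S \<inter> change_domain v' w' n'. change_marking v' x \<in> U}"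
    if U: "openin ?X U" and one: "\<And>j. j \<ge> m' \<Longrightarrow> v' j = One" "\<And>j. j \<ge> n' \<Longrightarrow> w' j = One"
    for U v' w' m' n'
  proof -
    obtain T where T: "open T" "U = S \<inter> T" using U by (auto simp: openin_open)
    have "{x \<in> S \<inter> change_domain v' w' n'. change_marking v' x \<in> U}
        = S \<inter> (change_domain v' w' n' \<inter> {x. change_marking v' x \<in> T})"
      using closed[of _ v' w' n' m', OF _ _ one] T(2) by auto
    moreover have "open (change_domain v' w' n' \<inter> {x. change_marking v' x \<in> T})"
      by (intro open_Int open_change_domain open_vimage_change_marking[of m'] T(1) one)
    ultimately show ?thesis by (simp add: openin_open_Int)
  qed
  from M obtain \<N> where \<N>: "countable \<N>" "\<And>N. N \<in> \<N> \<Longrightarrow> nowhere_dense_in ?X N" "M = \<Union>\<N>"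
    unfolding meager_in_def by blast
  have "nowhere_dense_in ?X (?P N)" if "N \<in> \<N>" for N
  proof (rule nowhere_dense_in_vimage[where \<psi> = "change_marking w" and E = "S \<inter> change_domain w v m"])
    show "openin ?X (S \<inter> change_domain v w n)"
      by (intro openin_open_Int open_change_domain w)
    show "openin ?X {x \<in> S \<inter> change_domain v w n. change_marking v x \<in> U}" if "openin ?X U" for U
      using op[OF that, of m v n w] v w by blast
    show "openin ?X {x \<in> S \<inter> change_domain w v m. change_marking w x \<in> U}" if "openin ?X U" for U
      using op[OF that, of n w m v] v w by blast
    show "change_marking v x \<in> S \<inter> change_domain w v m \<and> change_marking w (change_marking v x) = x"
      if "x \<in> S \<inter> change_domain v w n" for x
      using change_marking_inverse[of m v n w x] closed[of x v w n m] v w that by simp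
    show "change_marking w x \<in> S \<inter> change_domain v w n \<and> change_marking v (change_marking w x) = x"
      if "x \<in> S \<inter> change_domain w v m" for x
      using change_marking_inverse[of n w m v x] closed[of x w v m n] v w that by simp
  qed (rule \<N>(2)[OF that])
  moreover have "?P M = \<Union>(?P ` \<N>)" using \<N>(3) by auto
  ultimately show ?thesis
    unfolding meager_in_def using \<N>(1) by (intro exI[of _ "?P ` \<N>"]) auto
qed

section \<open>Sentences\<close>

lemma term_val_cong: "(\<And>i. i \<in> term_vars t \<Longrightarrow> e i = e' i) \<Longrightarrow> term_val G e t = term_val G e' t"
  by (induction t) auto

lemma sat_cong: "(\<And>i. i \<in> free_vars \<phi> \<Longrightarrow> e i = e' i) \<Longrightarrow> sat G \<phi> e = sat G \<phi> e'"
proof (induction \<phi> arbitrary: e e')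
  case (Eq s t)
  then have "term_val G e s = term_val G e' s" "term_val G e t = term_val G e' t"
    by (auto intro!: term_val_cong)
  then show ?case by (simp only: sat.simps)
next
  case (Neg \<phi>)
  have "sat G \<phi> e = sat G \<phi> e'" using Neg.prems by (intro Neg.IH) auto
  then show ?case by (simp only: sat.simps)
next
  case (Conj F)
  have "sat G (F n) e = sat G (F n) e'" for n
    using Conj.prems by (intro Conj.IH) auto
  then show ?case by (simp only: sat.simps)
next
  case (Disj F)
  have "sat G (F n) e = sat G (F n) e'" for n
    using Disj.prems by (intro Disj.IH) auto
  then show ?case by (simp only: sat.simps)
next
  case (All x \<phi>)
  have "sat G \<phi> (e(x := a)) = sat G \<phi> (e'(x := a))" for a
    using All.prems by (intro All.IH) auto
  then show ?case by (simp only: sat.simps)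
next
  case (Ex x \<phi>)
  have "sat G \<phi> (e(x := a)) = sat G \<phi> (e'(x := a))" for a
    using Ex.prems by (intro Ex.IH) auto
  then show ?case by (simp only: sat.simps)
qed

lemma sat_iso:
  assumes "group G" "group H" "f \<in> iso G H" "\<And>i. e i \<in> carrier G"
  shows "sat G \<phi> e \<longleftrightarrow> sat H \<phi> (f \<circ> e)"
  using assms(4)
proof (induction \<phi> arbitrary: e)
  case (Eq s t)
  have inj: "inj_on f (carrier G)" using assms(3) by (simp add: iso_def bij_betw_def)
  have hom: "f (term_val G e r) = term_val H (f \<circ> e) r" for r
    using assms(3) Eq by (intro hom_term_val[OF assms(1,2)]) (simp_all add: iso_def)
  have closed: "term_val G e r \<in> carrier G" for r
    using group.term_val_closed[OF assms(1)] Eq by blast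
  from inj_on_eq_iff[OF inj closed[of s] closed[of t]] show ?case
    by (simp only: sat.simps hom)
next
  case (All x \<phi>)
  have upd: "f \<circ> e(x := a) = (f \<circ> e)(x := f a)" for a by auto
  have "sat G \<phi> (e(x := a)) = sat H \<phi> ((f \<circ> e)(x := f a))" if "a \<in> carrier G" for a
    unfolding upd[symmetric] using All.prems that by (intro All.IH) simp
  moreover have "carrier H = f ` carrier G" using assms(3) by (simp add: iso_def bij_betw_def)
  ultimately show ?case by (simp add: comp_def)
next
  case (Ex x \<phi>)
  have upd: "f \<circ> e(x := a) = (f \<circ> e)(x := f a)" for a by auto
  have "sat G \<phi> (e(x := a)) = sat H \<phi> ((f \<circ> e)(x := f a))" if "a \<in> carrier G" for a
    unfolding upd[symmetric] using Ex.prems that by (intro Ex.IH) simp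
  moreover have "carrier H = f ` carrier G" using assms(3) by (simp add: iso_def bij_betw_def)
  ultimately show ?case by (simp add: comp_def)
qed simp_all

lemma models_iff:
  assumes "group G" "is_sentence \<sigma>"
  shows "models G \<sigma> \<longleftrightarrow> sat G \<sigma> (\<lambda>_. \<one>\<^bsub>G\<^esub>)"
proof -
  interpret group G by fact
  have "sat G \<sigma> e = sat G \<sigma> (\<lambda>_. \<one>\<^bsub>G\<^esub>)" for e
    using assms(2) by (intro sat_cong) (simp add: is_sentence_def)
  then show ?thesis unfolding models_def by auto
qed

lemma models_iso:
  assumes "group G" "group H" "f \<in> iso G H" "is_sentence \<sigma>"
  shows "models G \<sigma> \<longleftrightarrow> models H \<sigma>"
proof -
  interpret G: group G by fact
  have "f \<one>\<^bsub>G\<^esub> = \<one>\<^bsub>H\<^esub>" using assms(1,2,3) by (simp add: hom_one iso_def)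
  then have "f \<circ> (\<lambda>_::nat. \<one>\<^bsub>G\<^esub>) = (\<lambda>_. \<one>\<^bsub>H\<^esub>)" by auto
  then show ?thesis
    using sat_iso[OF assms(1-3), of "\<lambda>_. \<one>\<^bsub>G\<^esub>" \<sigma>] by (simp add: models_iff assms)
qed

text \<open>\<open>models_in\<close> asks for some representative whose group is a model;
  representatives of one point have isomorphic groups, so the given one may be tested.\<close>

lemma mk_in_models_in_iff:
  assumes "marked G A" "is_sentence \<sigma>"
  shows "mk G A \<in> models_in S \<sigma> \<longleftrightarrow> mk G A \<in> S \<and> models G \<sigma>"
proof
  assume "mk G A \<in> models_in S \<sigma>"
  then obtain H B where H: "mk G A = mk H B" "marked H B" "mk H B \<in> S" "models H \<sigma>"
    unfolding models_in_def by auto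
  then have "marked_eq (G, A) (H, B)" using mk_eq_iff[OF assms(1) H(2)] by simp
  then obtain f where "f \<in> iso G H" using marked_eq_tval by blast
  then show "mk G A \<in> S \<and> models G \<sigma>"
    using models_iso[OF marked_group[OF assms(1)] marked_group[OF H(2)] _ assms(2)] H by auto
next
  assume "mk G A \<in> S \<and> models G \<sigma>"
  then show "mk G A \<in> models_in S \<sigma>" using assms(1) unfolding models_in_def by auto
qed

lemma open_rel: "open {x. p \<in> rel x}"
proof (rule open_rel_nbhdI)
  fix x assume x: "x \<in> {x. p \<in> rel x}"
  obtain n where "x \<in> n_marked_groups n" using ex_n_marked_groups by blast
  then show "\<exists>n F. finite F \<and> x \<in> n_marked_groups n \<and> rel_nbhd n F x \<subseteq> {x. p \<in> rel x}"
    using x by (intro exI[of _ n] exI[of _ "{p}"]) (auto simp: rel_nbhd_def)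
qed

text \<open>Variables are assigned terms and not elements, so a fixed \<open>e\<close> has a meaning
  in every marked group and the points satisfying a formula under \<open>e\<close> form a set that
  can be examined topologically.\<close>

definition msat :: "marked_group \<Rightarrow> formula \<Rightarrow> (nat \<Rightarrow> gterm) \<Rightarrow> bool" where
  "msat x \<phi> e = sat (grp x) \<phi> (\<lambda>i. tval (grp x) (gens x) (e i))"

lemma msat_upd:
  "sat (grp x) \<phi> ((\<lambda>j. tval (grp x) (gens x) (e j))(i := tval (grp x) (gens x) t))
     = msat x \<phi> (e(i := t))"
  unfolding msat_def by (rule arg_cong[of _ _ "sat (grp x) \<phi>"]) auto

lemma msat_All: "msat x (All i \<phi>) e \<longleftrightarrow> (\<forall>k. msat x \<phi> (e(i := from_nat k)))"
proof -
  have "msat x (All i \<phi>) e \<longleftrightarrow> (\<forall>t. msat x \<phi> (e(i := t)))"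
    by (subst msat_def) (simp add: marked_carrier[OF marked_grp_gens] msat_upd)
  then show ?thesis by (metis from_nat_to_nat)
qed

lemma msat_Ex: "msat x (Ex i \<phi>) e \<longleftrightarrow> (\<exists>k. msat x \<phi> (e(i := from_nat k)))"
proof -
  have "msat x (Ex i \<phi>) e \<longleftrightarrow> (\<exists>t. msat x \<phi> (e(i := t)))"
    by (subst msat_def) (simp add: marked_carrier[OF marked_grp_gens] msat_upd)
  then show ?thesis by (metis from_nat_to_nat)
qed

text \<open>Equations define relatively open sets, and every other construct is a complement or a
  countable operation, the quantifiers through \<open>msat_All\<close> and \<open>msat_Ex\<close>.
  The induction runs over all \<open>e\<close> because quantifiers update it.\<close>

lemma baire_property_msat: "baire_property (top_of_set S) {x \<in> S. msat x \<phi> e}"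
proof (induction \<phi> arbitrary: e)
  case (Eq s t)
  have "{x \<in> S. msat x (Eq s t) e} = S \<inter> {x. (subst e s, subst e t) \<in> rel x}"
    by (auto simp: msat_def rel_def term_val_subst)
  then show ?case by (simp add: baire_property_openin openin_open_Int open_rel)
next
  case (Neg \<phi>)
  have "{x \<in> S. msat x (Neg \<phi>) e} = S - {x \<in> S. msat x \<phi> e}" by (auto simp: msat_def)
  then show ?case using baire_property_compl[OF Neg[of e]] by simp
next
  case (Conj F)
  have eq: "{x \<in> S. msat x (Conj F) e} = topspace (top_of_set S) \<inter> (\<Inter>k. {x \<in> S. msat x (F k) e})"
    by (auto simp: msat_def)
  show ?case unfolding eq by (rule baire_property_INT) (rule Conj.IH, simp)
next
  case (Disj F)
  have eq: "{x \<in> S. msat x (Disj F) e} = (\<Union>k. {x \<in> S. msat x (F k) e})"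
    by (auto simp: msat_def)
  show ?case unfolding eq by (rule baire_property_UN) (rule Disj.IH, simp)
next
  case (All i \<phi>)
  have eq: "{x \<in> S. msat x (All i \<phi>) e} =
      topspace (top_of_set S) \<inter> (\<Inter>k. {x \<in> S. msat x \<phi> (e(i := from_nat k))})"
    by (auto simp: msat_All)
  show ?case unfolding eq by (rule baire_property_INT) (rule All.IH)
next
  case (Ex i \<phi>)
  have eq: "{x \<in> S. msat x (Ex i \<phi>) e} = (\<Union>k. {x \<in> S. msat x \<phi> (e(i := from_nat k))})"
    by (auto simp: msat_Ex)
  show ?case unfolding eq by (rule baire_property_UN) (rule Ex.IH)
qed

lemma baire_property_models_in:
  assumes "is_sentence \<sigma>" shows "baire_property (top_of_set S) (models_in S \<sigma>)"
proof -
  have "x \<in> models_in S \<sigma> \<longleftrightarrow> x \<in> S \<and> msat x \<sigma> (\<lambda>_. One)" for x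
    using mk_in_models_in_iff[OF marked_grp_gens assms, of x S]
    by (simp add: mk_grp_gens msat_def models_iff[OF marked_group[OF marked_grp_gens] assms])
  then have "models_in S \<sigma> = {x \<in> S. msat x \<sigma> (\<lambda>_. One)}" by auto
  then show ?thesis by (simp add: baire_property_msat)
qed

lemma same_group_models_in:
  assumes "iso_invariant S" "is_sentence \<sigma>" "same_group x y" "x \<in> models_in S \<sigma>"
  shows "y \<in> models_in S \<sigma>"
proof -
  obtain G A B where G: "marked G A" "marked G B" "x = mk G A" "y = mk G B"
    using assms(3) unfolding same_group_def by auto
  have "x \<in> S" "models G \<sigma>"
    using assms(4) mk_in_models_in_iff[OF G(1) assms(2)] by (simp_all add: G(3))
  moreover have "y \<in> S" using same_group_closed[OF assms(1,3) \<open>x \<in> S\<close>] .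
  ultimately show ?thesis using mk_in_models_in_iff[OF G(2) assms(2)] by (simp add: G(4))
qed

section \<open>Sentences describing cylinders\<close>

primrec exs :: "nat \<Rightarrow> formula \<Rightarrow> formula" where
  "exs 0 \<phi> = \<phi>"
| "exs (Suc n) \<phi> = exs n (Ex n \<phi>)"

lemma free_vars_exs: "free_vars (exs n \<phi>) = free_vars \<phi> - {..<n}"
  by (induction n arbitrary: \<phi>) (auto simp: less_Suc_eq)

lemma sat_exs:
  "sat G (exs n \<phi>) e \<longleftrightarrow>
     (\<exists>A. length A = n \<and> set A \<subseteq> carrier G \<and> sat G \<phi> (\<lambda>i. if i < n then A ! i else e i))"
proof (induction n arbitrary: \<phi>)
  case (Suc n)
  have upd: "(\<lambda>i. if i < n then A ! i else e i)(n := a) = (\<lambda>i. if i < Suc n then (A @ [a]) ! i else e i)"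
    if "length A = n" for A a
    using that by (auto simp: fun_eq_iff nth_append less_Suc_eq)
  have "sat G (exs (Suc n) \<phi>) e \<longleftrightarrow> (\<exists>A. length A = n \<and> set A \<subseteq> carrier G \<and>
      (\<exists>a\<in>carrier G. sat G \<phi> (\<lambda>i. if i < Suc n then (A @ [a]) ! i else e i)))"
    using Suc.IH[of "Ex n \<phi>"] upd by (simp cong: conj_cong)
  also have "\<dots> \<longleftrightarrow> (\<exists>B. length B = Suc n \<and> set B \<subseteq> carrier G \<and>
      sat G \<phi> (\<lambda>i. if i < Suc n then B ! i else e i))" (is "?L \<longleftrightarrow> ?R")
  proof
    assume ?L
    then obtain A a where A: "length A = n" "set A \<subseteq> carrier G" "a \<in> carrier G"
      "sat G \<phi> (\<lambda>i. if i < Suc n then (A @ [a]) ! i else e i)" by auto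
    then show ?R by (intro exI[of _ "A @ [a]"]) simp
  next
    assume ?R
    then obtain B where B: "length B = Suc n" "set B \<subseteq> carrier G"
      "sat G \<phi> (\<lambda>i. if i < Suc n then B ! i else e i)" by auto
    then obtain A a where "B = A @ [a]" by (metis length_Suc_conv_rev)
    with B show ?L by (intro exI[of _ A]) auto
  qed
  finally show ?case .
qed simp

definition conj2 :: "formula \<Rightarrow> formula \<Rightarrow> formula" where
  "conj2 \<phi> \<psi> = Conj (\<lambda>k. if k = 0 then \<phi> else \<psi>)"

lemma free_vars_conj2: "free_vars (conj2 \<phi> \<psi>) = free_vars \<phi> \<union> free_vars \<psi>"
  by (auto simp: conj2_def split: if_splits)

lemma sat_conj2: "sat G (conj2 \<phi> \<psi>) e \<longleftrightarrow> sat G \<phi> e \<and> sat G \<psi> e"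
  by (auto simp: conj2_def split: if_splits)

text \<open>Under a marking of length \<open>n\<close> the variables from \<open>n\<close> on have
  value \<open>\<one>\<close>. Writing \<open>One\<close> for them keeps the value and leaves only
  variables that \<open>exs n\<close> binds.\<close>

definition restr :: "nat \<Rightarrow> gterm \<Rightarrow> gterm" where
  "restr n t = subst (\<lambda>i. if i < n then Var i else One) t"

lemma term_vars_restr: "term_vars (restr n t) \<subseteq> {..<n}"
  by (induction t) (auto simp: restr_def)

text \<open>Since \<open>Conj\<close> takes a sequence, it runs through all pairs of terms, and
  pairs outside \<open>L\<close> contribute the valid formula \<open>Eq One One\<close>; this covers
  the empty list as well.\<close>

definition conj_pairs :: "(gterm \<Rightarrow> gterm \<Rightarrow> formula) \<Rightarrow> (gterm \<times> gterm) list \<Rightarrow> formula" where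
  "conj_pairs f L =
     Conj (\<lambda>k. case from_nat k of (s, t) \<Rightarrow> if (s, t) \<in> set L then f s t else Eq One One)"

lemma all_from_nat: "(\<forall>k. P (from_nat k)) \<longleftrightarrow> (\<forall>p. P p)"
  by (metis from_nat_to_nat)

lemma sat_conj_pairs: "sat G (conj_pairs f L) e \<longleftrightarrow> (\<forall>(s, t)\<in>set L. sat G (f s t) e)"
proof -
  have "sat G (conj_pairs f L) e \<longleftrightarrow>
      (\<forall>k. case from_nat k of (s, t) \<Rightarrow> (s, t) \<in> set L \<longrightarrow> sat G (f s t) e)"
    unfolding conj_pairs_def sat.simps by (intro arg_cong[of _ _ HOL.All] ext) (simp split: prod.split)
  also have "\<dots> \<longleftrightarrow> (\<forall>p. case p of (s, t) \<Rightarrow> (s, t) \<in> set L \<longrightarrow> sat G (f s t) e)"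
    by (rule all_from_nat)
  finally show ?thesis by auto
qed

lemma free_vars_conj_pairs:
  assumes "\<And>s t. free_vars (f s t) \<subseteq> V" shows "free_vars (conj_pairs f L) \<subseteq> V"
proof -
  have "free_vars (case p of (s, t) \<Rightarrow> if (s, t) \<in> set L then f s t else Eq One One) \<subseteq> V" for p
    using assms by (cases p) simp
  then show ?thesis unfolding conj_pairs_def free_vars.simps by (rule UN_least)
qed

text \<open>A group satisfies this sentence iff some generating tuple puts it into the cylinder.\<close>

definition cylinder_sentence ::
  "nat \<Rightarrow> (gterm \<times> gterm) list \<Rightarrow> (gterm \<times> gterm) list \<Rightarrow> formula" where
  "cylinder_sentence n L L' = exs n (conj2 (All n (Disj (\<lambda>k. Eq (Var n) (restr n (from_nat k)))))
     (conj2 (conj_pairs (\<lambda>s t. Eq (restr n s) (restr n t)) L)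
       (conj_pairs (\<lambda>s t. Neg (Eq (restr n s) (restr n t))) L')))"

lemma is_sentence_cylinder_sentence: "is_sentence (cylinder_sentence n L L')"
proof -
  have "free_vars (conj_pairs (\<lambda>s t. Eq (restr n s) (restr n t)) L) \<subseteq> {..<n}"
    "free_vars (conj_pairs (\<lambda>s t. Neg (Eq (restr n s) (restr n t))) L') \<subseteq> {..<n}"
    by (rule free_vars_conj_pairs, simp add: term_vars_restr)+
  moreover have "free_vars (All n (Disj (\<lambda>k. Eq (Var n) (restr n (from_nat k))))) \<subseteq> {..<n}"
    by (auto dest: subsetD[OF term_vars_restr])
  ultimately show ?thesis
    unfolding is_sentence_def cylinder_sentence_def free_vars_exs free_vars_conj2 by blast
qed

lemma models_cylinder_sentence:
  assumes "group G"
  shows "models G (cylinder_sentence n L L') \<longleftrightarrow>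
    (\<exists>A. length A = n \<and> marked G A \<and> mk G A \<in> cylinder n L L')"
proof -
  have "sat G (conj2 (All n (Disj (\<lambda>k. Eq (Var n) (restr n (from_nat k)))))
     (conj2 (conj_pairs (\<lambda>s t. Eq (restr n s) (restr n t)) L)
       (conj_pairs (\<lambda>s t. Neg (Eq (restr n s) (restr n t))) L')))
      (\<lambda>i. if i < n then A ! i else \<one>\<^bsub>G\<^esub>) \<longleftrightarrow> marked G A \<and> mk G A \<in> cylinder n L L'"
    (is "sat G ?\<phi> _ \<longleftrightarrow> _") if A: "length A = n" "set A \<subseteq> carrier G" for A
  proof -
    have env: "(\<lambda>i. if i < n then A ! i else \<one>\<^bsub>G\<^esub>) = marking_env G A"
      by (auto simp: marking_env_def A(1))
    have restr: "term_val G (marking_env G A) (restr n t) = tval G A t" for t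
      unfolding restr_def term_val_subst
      by (rule arg_cong[of _ _ "\<lambda>e. term_val G e t"]) (auto simp: marking_env_def A(1))
    \<comment> \<open>Only variables below \<open>n\<close> occur in \<open>restr n t\<close>, so
      the universally quantified variable \<open>n\<close> is fresh and its value does not affect
      the term.\<close>
    have restr_upd: "term_val G ((marking_env G A)(n := a)) (restr n t) = tval G A t" for a t
      using term_vars_restr[of n t] by (subst restr[symmetric]) (rule term_val_cong, auto)
    have "(\<forall>a\<in>carrier G. \<exists>k. a = tval G A (from_nat k)) \<longleftrightarrow> carrier G \<subseteq> range (tval G A)"
      unfolding subset_iff image_iff by (metis UNIV_I from_nat_to_nat)
    then have "(\<forall>a\<in>carrier G. \<exists>k. a = tval G A (from_nat k)) \<longleftrightarrow> marked G A"
      using assms A(2) by (simp add: marked_iff_range_tval)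
    then have "sat G ?\<phi> (marking_env G A) \<longleftrightarrow> marked G A \<and>
        (\<forall>(s, t)\<in>set L. tval G A s = tval G A t) \<and> (\<forall>(s, t)\<in>set L'. tval G A s \<noteq> tval G A t)"
      by (simp add: sat_conj2 sat_conj_pairs restr restr_upd)
    also have "\<dots> \<longleftrightarrow> marked G A \<and> mk G A \<in> cylinder n L L'"
      using mk_in_n_marked_groups[of G A] A(1) by (auto simp: cylinder_def rel_mk)
    finally show ?thesis unfolding env .
  qed
  then have "sat G (cylinder_sentence n L L') (\<lambda>_. \<one>\<^bsub>G\<^esub>) \<longleftrightarrow>
    (\<exists>A. length A = n \<and> set A \<subseteq> carrier G \<and> marked G A \<and> mk G A \<in> cylinder n L L')"
    unfolding cylinder_sentence_def sat_exs by (simp cong: conj_cong)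
  moreover have "set A \<subseteq> carrier G \<and> marked G A \<and> Q \<longleftrightarrow> marked G A \<and> Q" for A Q
    using marked_subset[of G A] by auto
  ultimately show ?thesis
    by (simp only: models_iff[OF assms is_sentence_cylinder_sentence])
qed

section \<open>The zero-one law\<close>

text \<open>An isomorphism carries the marking of \<open>K\<close> over to \<open>H\<close>, so that
  both points are represented by markings of \<open>H\<close>.\<close>

lemma iso_class_same_group:
  assumes "x \<in> iso_class G" "y \<in> iso_class G" shows "same_group x y"
proof -
  obtain H A where H: "x = mk H A" "marked H A" "H \<cong> G"
    using assms(1) unfolding iso_class_def by auto
  obtain K B where K: "y = mk K B" "marked K B" "K \<cong> G"
    using assms(2) unfolding iso_class_def by auto
  note gH = marked_group[OF H(2)] and gK = marked_group[OF K(2)]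
  have "G \<cong> H" using group.iso_sym[OF gH H(3)] .
  with K(3) have "K \<cong> H" by (rule iso_trans)
  then obtain f where f: "f \<in> iso K H" unfolding is_iso_def by auto
  then have inj: "inj_on f (carrier K)" and ran: "carrier H = f ` carrier K" and hom: "f \<in> hom K H"
    by (simp_all add: iso_def bij_betw_def)
  have sub: "set (map f B) \<subseteq> carrier H" using marked_subset[OF K(2)] ran by auto
  have "f \<one>\<^bsub>K\<^esub> = \<one>\<^bsub>H\<^esub>" using hom gH gK by (simp add: hom_one)
  then have "f \<circ> marking_env K B = marking_env H (map f B)"
    by (auto simp: marking_env_def)
  then have tv: "f (tval K B t) = tval H (map f B) t" for t
    using hom_term_val[OF gK gH hom marking_env_closed[OF gK marked_subset[OF K(2)]]] by simp
  have "carrier H = range (tval H (map f B))"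
    unfolding ran marked_carrier[OF K(2)] image_image tv ..
  then have m: "marked H (map f B)"
    unfolding marked_iff_range_tval using gH sub by simp
  have "y = mk H (map f B)"
    unfolding K(1)
  proof (rule mk_eqI[OF K(2) m])
    fix s t
    show "tval K B s = tval K B t \<longleftrightarrow> tval H (map f B) s = tval H (map f B) t"
      unfolding tv[symmetric]
      using inj_on_eq_iff[OF inj] tval_closed[OF gK marked_subset[OF K(2)]] by simp
  qed
  with H m show ?thesis unfolding same_group_def by auto
qed

lemma same_group_iso_class:
  assumes "same_group x y"
  obtains G :: "nat monoid" where "fin_gen_group G" "x \<in> iso_class G" "y \<in> iso_class G"
proof -
  obtain G A B where G: "marked G A" "marked G B" "x = mk G A" "y = mk G B"
    using assms unfolding same_group_def by auto
  have "mk G C \<in> iso_class G" if "marked G C" for C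
    unfolding iso_class_def by (intro CollectI exI conjI) (rule HOL.refl that iso_refl)+
  moreover have "fin_gen_group G"
    unfolding fin_gen_group_def
    by (intro conjI exI[of _ "set A"]) (use G(1) in \<open>auto simp: marked_def\<close>)
  ultimately show thesis using that G by auto
qed

lemma same_group_in_iso_class_grp:
  assumes "same_group x y" shows "y \<in> iso_class (grp x)"
proof -
  obtain G A B where G: "marked G A" "marked G B" "x = mk G A" "y = mk G B"
    using assms unfolding same_group_def by auto
  have "mk G A = mk (grp x) (gens x)" by (simp add: mk_grp_gens G(3))
  then have "marked_eq (G, A) (grp x, gens x)" using mk_eq_iff[OF G(1) marked_grp_gens] by simp
  then obtain f where "f \<in> iso G (grp x)" using marked_eq_tval by blast
  then have "G \<cong> grp x" by (auto simp: is_iso_def)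
  then show ?thesis
    unfolding iso_class_def G(4) by (intro CollectI exI conjI) (rule HOL.refl G(2) | assumption)+
qed

lemma fin_gen_group_grp: "fin_gen_group (grp x)"
  unfolding fin_gen_group_def
  by (intro conjI exI[of _ "set (gens x)"])
    (use marked_grp_gens[of x] in \<open>auto simp: marked_def\<close>)

definition topologically_transitive :: "marked_group set \<Rightarrow> bool" where
  "topologically_transitive S \<longleftrightarrow> (\<forall>U V. openin (top_of_set S) U \<and> openin (top_of_set S) V
     \<and> U \<noteq> {} \<and> V \<noteq> {} \<longrightarrow> (\<exists>x\<in>U. \<exists>y\<in>V. same_group x y))"

lemma topologically_transitive_iff:
  "topologically_transitive S \<longleftrightarrow>
     (\<forall>U V. openin (top_of_set S) U \<and> openin (top_of_set S) V \<and> U \<noteq> {} \<and> V \<noteq> {} \<longrightarrow>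
        (\<exists>G :: nat monoid. fin_gen_group G \<and> iso_class G \<inter> U \<noteq> {} \<and> iso_class G \<inter> V \<noteq> {}))"
proof -
  have "(\<exists>x\<in>U. \<exists>y\<in>V. same_group x y) \<longleftrightarrow>
     (\<exists>G :: nat monoid. fin_gen_group G \<and> iso_class G \<inter> U \<noteq> {} \<and> iso_class G \<inter> V \<noteq> {})"
    (is "?L \<longleftrightarrow> ?R") for U V
  proof
    assume ?L
    then obtain x y where xy: "x \<in> U" "y \<in> V" "same_group x y" by auto
    obtain G :: "nat monoid" where "fin_gen_group G" "x \<in> iso_class G" "y \<in> iso_class G"
      using same_group_iso_class[OF xy(3)] .
    with xy show ?R by (intro exI[of _ G]) auto
  next
    assume ?R
    then obtain G :: "nat monoid" and x y where "x \<in> iso_class G" "y \<in> iso_class G" "x \<in> U" "y \<in> V"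
      by auto
    then show ?L using iso_class_same_group by metis
  qed
  then show ?thesis unfolding topologically_transitive_def by simp
qed

lemma open_saturation:
  assumes "iso_invariant S" "open U"
  shows "openin (top_of_set S) {x \<in> S. \<exists>y\<in>S \<inter> U. same_group x y}" (is "openin _ ?Sat")
proof (subst openin_subopen, intro ballI)
  fix x assume "x \<in> ?Sat"
  then obtain y where xy: "x \<in> S" "y \<in> U" "same_group x y" by auto
  obtain G A B where G: "marked G A" "marked G B" "x = mk G A" "y = mk G B"
    using xy(3) unfolding same_group_def by auto
  obtain v w m n where v: "\<And>j. j \<ge> m \<Longrightarrow> v j = One" and w: "\<And>i. i \<ge> n \<Longrightarrow> w i = One"
    and x: "x \<in> change_domain v w n" "change_marking v x = y"
    unfolding G(3,4) using ex_change_marking[OF G(1,2)] by metis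
  \<comment> \<open>The terms \<open>v\<close> taking \<open>x\<close> to \<open>y\<close> work on a
    whole neighbourhood of \<open>x\<close>, and by continuity the changed marking stays in
    \<open>U\<close> nearby.\<close>
  let ?T = "S \<inter> (change_domain v w n \<inter> {z. change_marking v z \<in> U})"
  have "openin (top_of_set S) ?T"
    by (intro openin_open_Int open_Int open_change_domain open_vimage_change_marking[of m] assms(2) v w)
  moreover have "x \<in> ?T" using x xy by simp
  moreover have "?T \<subseteq> ?Sat"
  proof
    fix z assume z: "z \<in> ?T"
    then have "same_group z (change_marking v z)"
      using change_marking_inverse(3)[of m v n w z] v w by simp
    with same_group_closed[OF assms(1) this] z show "z \<in> ?Sat" by auto
  qed
  ultimately show "\<exists>T. openin (top_of_set S) T \<and> x \<in> T \<and> T \<subseteq> ?Sat" by auto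
qed

lemma topologically_transitive_imp_dense_class:
  assumes S: "iso_invariant S" "closed S" and trans: "topologically_transitive S"
  shows "\<exists>G :: nat monoid. fin_gen_group G \<and> dense_in_space (top_of_set S) (iso_class G)"
proof (cases "S = {}")
  case True
  \<comment> \<open>In the empty space every class is dense, so any finitely generated group will
    do.\<close>
  then have "dense_in_space (top_of_set S) (iso_class (grp undefined))"
    unfolding dense_in_space_def by (simp add: closure_of_def)
  then show ?thesis using fin_gen_group_grp by auto
next
  case False
  let ?X = "top_of_set S"
  define Sat where "Sat = (\<lambda>(n, L, L'). {x \<in> S. \<exists>y\<in>S \<inter> cylinder n L L'. same_group x y})"
  define I where "I = {(n, L, L'). S \<inter> cylinder n L L' \<noteq> {}}"
  \<comment> \<open>The saturation of a cylinder that meets \<open>S\<close> is open, and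
    transitivity makes it meet every non-empty open set; hence its complement is nowhere
    dense.\<close>
  have nd: "nowhere_dense_in ?X (S - Sat c)" if "c \<in> I" for c
    unfolding nowhere_dense_in_iff
  proof (intro conjI allI impI)
    obtain n L L' where c: "c = (n, L, L')" by (cases c)
    fix U assume U: "openin ?X U \<and> U \<noteq> {}"
    have "openin ?X (S \<inter> cylinder n L L')" by (intro openin_open_Int open_cylinder)
    moreover have "S \<inter> cylinder n L L' \<noteq> {}" using that by (simp add: I_def c)
    ultimately obtain x y where "x \<in> U" "y \<in> S \<inter> cylinder n L L'" "same_group x y"
      using trans U unfolding topologically_transitive_def by metis
    moreover have "x \<in> S" using \<open>x \<in> U\<close> U openin_subset[of ?X U] by auto
    ultimately have "x \<in> U \<inter> Sat c" by (auto simp: Sat_def c)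
    moreover have "openin ?X (Sat c)"
      using open_saturation[OF S(1) open_cylinder] by (simp add: Sat_def c)
    then have "openin ?X (U \<inter> Sat c)" using U by (simp add: openin_Int)
    ultimately show "\<exists>V. openin ?X V \<and> V \<noteq> {} \<and> V \<subseteq> U \<and> V \<inter> (S - Sat c) = {}"
      by (intro exI[of _ "U \<inter> Sat c"]) auto
  qed auto
  have "meager_in ?X (\<Union>c\<in>I. S - Sat c)"
    unfolding meager_in_def
  proof (intro exI conjI)
    show "countable ((\<lambda>c. S - Sat c) ` I)" by simp
  qed (use nd in auto)
  then have "(\<Union>c\<in>I. S - Sat c) \<noteq> S"
    using openin_meager_empty[OF S(2), of S] False openin_subtopology_self by metis
  then obtain x where x: "x \<in> S" "\<And>c. c \<in> I \<Longrightarrow> x \<in> Sat c" by auto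
  have "?X closure_of (iso_class (grp x)) = topspace ?X"
  proof (intro equalityI subsetI)
    fix y assume "y \<in> topspace ?X"
    moreover have "\<exists>z. z \<in> iso_class (grp x) \<and> z \<in> T" if T: "y \<in> T \<and> openin ?X T" for T
    proof -
      obtain U where U: "open U" "T = S \<inter> U" using T by (auto simp: openin_open)
      then have "y \<in> U" "y \<in> S" using T by auto
      obtain n L L' where c: "y \<in> cylinder n L L'" "cylinder n L L' \<subseteq> U"
        using cylinder_basis[OF U(1) \<open>y \<in> U\<close>] .
      then have "(n, L, L') \<in> I" using \<open>y \<in> S\<close> by (auto simp: I_def)
      from x(2)[OF this] obtain z where "z \<in> S \<inter> cylinder n L L'" "same_group x z"
        by (auto simp: Sat_def)
      then show ?thesis
        using c(2) U(2) same_group_in_iso_class_grp[OF \<open>same_group x z\<close>] by auto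
    qed
    ultimately show "y \<in> ?X closure_of (iso_class (grp x))"
      unfolding in_closure_of by simp
  qed (simp add: in_closure_of)
  then show ?thesis using fin_gen_group_grp unfolding dense_in_space_def by auto
qed

lemma dense_class_imp_topologically_transitive:
  assumes "dense_in_space (top_of_set S) (iso_class G)"
  shows "topologically_transitive S"
  unfolding topologically_transitive_def
proof (intro allI impI)
  fix U V assume UV: "openin (top_of_set S) U \<and> openin (top_of_set S) V \<and> U \<noteq> {} \<and> V \<noteq> {}"
  have meets: "\<exists>x. x \<in> iso_class G \<and> x \<in> W" if W: "openin (top_of_set S) W" "W \<noteq> {}" for W
  proof -
    obtain w where w: "w \<in> W" using W(2) by auto
    then have "w \<in> topspace (top_of_set S)" using openin_subset[OF W(1)] by auto
    then have "w \<in> top_of_set S closure_of (iso_class G)"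
      using assms by (simp add: dense_in_space_def)
    then show ?thesis unfolding in_closure_of using w W(1) by auto
  qed
  obtain x y where "x \<in> iso_class G" "x \<in> U" "y \<in> iso_class G" "y \<in> V"
    using meets[of U] meets[of V] UV by auto
  then show "\<exists>x\<in>U. \<exists>y\<in>V. same_group x y" using iso_class_same_group by metis
qed

lemma topologically_transitive_imp_zero_one_law:
  assumes S: "iso_invariant S" "closed S" and trans: "topologically_transitive S"
  shows "zero_one_law S"
  unfolding zero_one_law_def
proof (intro allI impI)
  let ?X = "top_of_set S"
  fix \<sigma> assume \<sigma>: "is_sentence \<sigma>"
  let ?M = "models_in S \<sigma>"
  have "?M \<subseteq> S" unfolding models_in_def by auto
  have "baire_property ?X ?M" using \<sigma> by (rule baire_property_models_in)
  then obtain U where U: "openin ?X U" "meager_in ?X (?M - U)" "meager_in ?X (U - ?M)"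
    unfolding baire_property_def by auto
  have "baire_property ?X (S - ?M)"
    using baire_property_compl[OF \<open>baire_property ?X ?M\<close>] by simp
  then obtain V where V: "openin ?X V" "meager_in ?X ((S - ?M) - V)" "meager_in ?X (V - (S - ?M))"
    unfolding baire_property_def by auto
  show "meager_in ?X ?M \<or> comeager_in ?X ?M"
  \<comment> \<open>\<open>U\<close> and \<open>V\<close> approximate the models and the non-models
    up to meager sets; if one of them is empty, the set it approximates is meager.\<close>
  proof (cases "U = {} \<or> V = {}")
    case True
    then show ?thesis using U(2) V(2) \<open>?M \<subseteq> S\<close> by (auto simp: comeager_in_def)
  next
    case False
    then obtain x y where xy: "x \<in> U" "y \<in> V" "same_group x y"
      using trans U(1) V(1) unfolding topologically_transitive_def by metis
    obtain G A B where G: "marked G A" "marked G B" "x = mk G A" "y = mk G B"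
      using xy(3) unfolding same_group_def by auto
    obtain v w m n where v: "\<And>j. j \<ge> m \<Longrightarrow> v j = One" and w: "\<And>i. i \<ge> n \<Longrightarrow> w i = One"
      and x: "x \<in> change_domain v w n" "change_marking v x = y"
      unfolding G(3,4) using ex_change_marking[OF G(1,2)] by metis
    obtain T where T: "open T" "V = S \<inter> T" using V(1) by (auto simp: openin_open)
    \<comment> \<open>\<open>?W\<close> consists of the points of \<open>U\<close> that the change
      of marking takes into \<open>V\<close>. Points of \<open>?N\<close> are taken to models in
      \<open>V\<close>, which are exceptional because \<open>V\<close> approximates the
      non-models.\<close>
    let ?W = "U \<inter> (S \<inter> (change_domain v w n \<inter> {z. change_marking v z \<in> T}))"
    let ?N = "{z \<in> S \<inter> change_domain v w n. change_marking v z \<in> V - (S - ?M)}"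
    have W: "openin ?X ?W"
      by (intro openin_Int U(1) openin_open_Int open_Int open_change_domain
          open_vimage_change_marking[of m] T(1) v w)
    \<comment> \<open>A non-model in \<open>?W\<close> is exceptional in \<open>U\<close>; a model
      remains one after the change of marking, so its image is exceptional in \<open>V\<close>. This
      makes the open set \<open>?W\<close> meager although it contains \<open>x\<close>.\<close>
    have sub: "?W \<subseteq> (U - ?M) \<union> ?N"
    proof
      fix z assume z: "z \<in> ?W"
      show "z \<in> (U - ?M) \<union> ?N"
      proof (cases "z \<in> ?M")
        case True
        have "same_group z (change_marking v z)"
          using z change_marking_inverse(3)[of m v n w z] v w by simp
        then have "change_marking v z \<in> ?M"
          using same_group_models_in[OF S(1) \<sigma> _ True] by simp
        then show ?thesis using z T(2) \<open>?M \<subseteq> S\<close> by auto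
      qed (use z in auto)
    qed
    have "meager_in ?X ?N"
      by (rule meager_in_vimage_change_marking[OF S(1) _ _ V(3), of m v n w]) (simp_all add: v w)
    then have "meager_in ?X ((U - ?M) \<union> ?N)" by (intro meager_in_Un U(3))
    from openin_meager_empty[OF S(2) W meager_in_subset[OF this sub]] have "?W = {}" .
    moreover have "x \<in> ?W"
      using x xy T(2) openin_subset[OF U(1)] by auto
    ultimately show ?thesis by auto
  qed
qed

text \<open>A non-empty trace of a cylinder on \<open>S\<close> fits inside \<open>U\<close>. The
  models of the cylinder's sentence contain this trace, so they are not meager; by the law they are
  comeager and meet \<open>V\<close>. A model found in \<open>V\<close> has another marking in the
  cylinder, which is a point of \<open>U\<close>.\<close>

lemma zero_one_law_imp_topologically_transitive:
  assumes S: "iso_invariant S" "closed S" and law: "zero_one_law S"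
  shows "topologically_transitive S"
  unfolding topologically_transitive_def
proof (intro allI impI)
  let ?X = "top_of_set S"
  fix U V assume UV: "openin ?X U \<and> openin ?X V \<and> U \<noteq> {} \<and> V \<noteq> {}"
  obtain T where T: "open T" "U = S \<inter> T" using UV by (auto simp: openin_open)
  then obtain x where x: "x \<in> S" "x \<in> T" using UV by auto
  obtain n L L' where c: "x \<in> cylinder n L L'" "cylinder n L L' \<subseteq> T"
    using cylinder_basis[OF T(1) x(2)] .
  let ?\<sigma> = "cylinder_sentence n L L'"
  have sub: "S \<inter> cylinder n L L' \<subseteq> models_in S ?\<sigma>"
  proof
    fix y assume y: "y \<in> S \<inter> cylinder n L L'"
    then obtain G A where G: "marked G A" "length A = n" "y = mk G A"
      by (auto simp: cylinder_def elim: n_marked_groupsE)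
    then have "models G ?\<sigma>"
      using models_cylinder_sentence[OF marked_group[OF G(1)]] y by auto
    then show "y \<in> models_in S ?\<sigma>"
      using mk_in_models_in_iff[OF G(1) is_sentence_cylinder_sentence] y G(3) by simp
  qed
  have "\<not> meager_in ?X (models_in S ?\<sigma>)"
  proof
    assume "meager_in ?X (models_in S ?\<sigma>)"
    then have "meager_in ?X (S \<inter> cylinder n L L')" using sub meager_in_subset by metis
    then have "S \<inter> cylinder n L L' = {}"
      by (intro openin_meager_empty[OF S(2)] openin_open_Int open_cylinder)
    then show False using x(1) c(1) by auto
  qed
  then have "comeager_in ?X (models_in S ?\<sigma>)"
    using law is_sentence_cylinder_sentence unfolding zero_one_law_def by metis
  then have m: "meager_in ?X (S - models_in S ?\<sigma>)" by (simp add: comeager_in_def)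
  have "\<not> V \<subseteq> S - models_in S ?\<sigma>"
    using openin_meager_empty[OF S(2), of V] meager_in_subset[OF m] UV by metis
  moreover have "V \<subseteq> S" using UV openin_subset[of ?X V] by auto
  ultimately obtain y where y: "y \<in> V" "y \<in> models_in S ?\<sigma>" by auto
  obtain G A where G: "marked G A" "y = mk G A" using ex_mk by blast
  have "models G ?\<sigma>"
    using mk_in_models_in_iff[OF G(1) is_sentence_cylinder_sentence] y(2) G(2) by simp
  then obtain B where B: "marked G B" "mk G B \<in> cylinder n L L'"
    using models_cylinder_sentence[OF marked_group[OF G(1)]] by auto
  have "same_group y (mk G B)" unfolding same_group_def using G B(1) by auto
  moreover have "mk G B \<in> U"
    using same_group_closed[OF S(1) calculation] y(1) \<open>V \<subseteq> S\<close> B(2) c(2) T(2) by auto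
  ultimately show "\<exists>x\<in>U. \<exists>y\<in>V. same_group x y" using y(1) same_group_sym by metis
qed

theorem theorem2p2:
  fixes S :: "marked_group set"
  assumes "iso_invariant S" and "closed S"
  shows "((\<forall>U V. openin (top_of_set S) U \<and> openin (top_of_set S) V \<and> U \<noteq> {} \<and> V \<noteq> {} \<longrightarrow>
             (\<exists>G :: nat monoid. fin_gen_group G \<and> iso_class G \<inter> U \<noteq> {} \<and> iso_class G \<inter> V \<noteq> {}))
          \<longleftrightarrow> (\<exists>G :: nat monoid. fin_gen_group G \<and> dense_in_space (top_of_set S) (iso_class G)))
       \<and> ((\<exists>G :: nat monoid. fin_gen_group G \<and> dense_in_space (top_of_set S) (iso_class G))
          \<longleftrightarrow> zero_one_law S)"
  unfolding topologically_transitive_iff[symmetric]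
  using topologically_transitive_imp_dense_class[OF assms]
    topologically_transitive_imp_zero_one_law[OF assms]
    zero_one_law_imp_topologically_transitive[OF assms]
    dense_class_imp_topologically_transitive[of S]
  by metis

end
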